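(* Let $n\ge 2$ and $m\ge 1$ be integers. Let $F:\mathbb{B}^n\to\mathbb{R}^{m+1}$ be a harmonic mapping such that $F(\mathbb{B}^n)\subset\mathbb{B}^{m+1}$ and $F(0)=(a,b)$, where $a\in\mathbb{R}^m$ and $b\in\mathbb{R}$. Let $0<r<1$. Then $$F(\overline{B^n_r})\subset E_{r,(a,b)},$$ where $$E_{r,(a,b)}=\bigcap_{e\in\mathbb{R}^{m+1},\,|e|=1}R_e,\qquad R_e=\{x\in\mathbb{R}^{m+1}:\langle x,e\rangle\le\langle F_{(a,b)Q_e,r}(rN),e_0\rangle\},$$ $e_0=(1,0,\dots,0)\in\mathbb{R}^{m+1}$, and, for each unit vector $e$, $Q_e$ is an orthogonal $(m+1)\times(m+1)$ matrix such that $eQ_e=e_0$.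
   Context: Vectors are row vectors and matrices act on the right; $|\cdot|$ and $\langle\cdot,\cdot\rangle$ are the Euclidean norm and inner product. $\mathbb{B}^k$ is the open unit ball of $\mathbb{R}^k$, $\overline{B^n_r}=\{x\in\mathbb{R}^n:|x|\le r\}$, $S$ is the unit sphere in $\mathbb{R}^n$, $\sigma$ is surface-area measure on $S$ normalized so that $\sigma(S)=1$, and $N=(0,\dots,0,1)\in S$. A mapping into $\mathbb{R}^{m+1}$ is harmonic if each of its components is $C^2$ with zero Laplacian. Definition of $F_{a,b,r}$, for $a\in\mathbb{R}^m$, $b\in\mathbb{R}$, $|a|^2+b^2<1$, $0<r<1$. Let $l=(1,0,\dots,0)\in\mathbb{R}^m$. For $b\ge 0$ let $\mathcal{U}_{a,b}$ be the class of (real vector-valued) $u\in(L^\infty(S))^m$ with $\|u\|_\infty\le 1$ (i.e. $|u(\omega)|\le 1$ a.e.), $\int_S u\,d\sigma=a$ and $\int_S\sqrt{1-|u(\omega)|^2}\,d\sigma\ge b$. Let $L_r(u)=\int_S\frac{1-r^2}{|rN-\omega|^n}\langle u(\omega),l\rangle\,d\sigma$. There is a unique (up to a.e. equality) element $u_{a,b,r}\in\mathcal{U}_{a,b}$ at which $L_r$ attains its maximum on $\mathcal{U}_{a,b}$. Put $v_{a,b,r}(\omega)=\sqrt{1-|u_{a,b,r}(\omega)|^2}$ and, for $x\in\mathbb{B}^n$, $$U_{a,b,r}(x)=\int_S\frac{1-|x|^2}{|x-\omega|^n}u_{a,b,r}(\omega)\,d\sigma,\qquad V_{a,b,r}(x)=\int_S\frac{1-|x|^2}{|x-\omega|^n}v_{a,b,r}(\omega)\,d\sigma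 .$$ For $b<0$ put $U_{a,b,r}=U_{a,-b,r}$ and $V_{a,b,r}=-V_{a,-b,r}$. Finally $F_{a,b,r}(x)=(U_{a,b,r}(x),V_{a,b,r}(x))\in\mathbb{R}^{m+1}$. The notation $F_{(a,b)Q_e,r}$ means $F_{a',b',r}$ where $(a',b')=(a,b)Q_e$ with $a'\in\mathbb{R}^m$, $b'\in\mathbb{R}$. *)

theory Defs
  imports "HOL-Analysis.Analysis"
begin

subsection \<open>Coordinates\<close>

text \<open>
  The index types carry a linear order, so that a first and a last coordinate make sense.
  The space of dimension \<open>m + 1\<close> has the index type \<open>'m + 1\<close>, where \<open>Inl\<close> gives the first \<open>m\<close>
  coordinates and \<open>Inr 1\<close> the last one.
\<close>

definition first_axis :: "real^('m::{finite,linorder})" where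
  "first_axis = axis (Min UNIV) 1"

definition north_pole :: "real^('n::{finite,linorder})" where
  "north_pole = axis (Max UNIV) 1"

definition vec_pair :: "real^('m::finite) \<Rightarrow> real \<Rightarrow> real^('m + 1)" where
  "vec_pair a b = (\<chi> k. case k of Inl j \<Rightarrow> a $ j | Inr _ \<Rightarrow> b)"

definition vec_init :: "real^('m::finite + 1) \<Rightarrow> real^'m" where
  "vec_init x = (\<chi> j. x $ Inl j)"

definition vec_last :: "real^('m::finite + 1) \<Rightarrow> real" where
  "vec_last x = x $ Inr 1"

definition e\<^sub>0 :: "real^('m::{finite,linorder} + 1)" where
  "e\<^sub>0 = vec_pair first_axis 0"

lemma vec_init_pair [simp]: "vec_init (vec_pair a b) = a"
  by (simp add: vec_init_def vec_pair_def)

lemma vec_last_pair [simp]: "vec_last (vec_pair a b) = b"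
  by (simp add: vec_last_def vec_pair_def)


subsection \<open>Harmonic mappings\<close>

definition partial_deriv :: "'n \<Rightarrow> (real^'n \<Rightarrow> real) \<Rightarrow> real^('n::finite) \<Rightarrow> real" where
  "partial_deriv i f x = deriv (\<lambda>t. f (x + t *\<^sub>R axis i 1)) 0"

definition C1_on :: "(real^('n::finite) \<Rightarrow> real) \<Rightarrow> (real^'n) set \<Rightarrow> bool" where
  "C1_on f S \<longleftrightarrow> (\<forall>i.
     (\<forall>x\<in>S. (\<lambda>t. f (x + t *\<^sub>R axis i 1)) differentiable (at 0)) \<and>
     continuous_on S (partial_deriv i f))"

definition C2_on :: "(real^('n::finite) \<Rightarrow> real) \<Rightarrow> (real^'n) set \<Rightarrow> bool" where
  "C2_on f S \<longleftrightarrow> C1_on f S \<and> (\<forall>i. C1_on (partial_deriv i f) S)"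

definition laplacian :: "(real^'n \<Rightarrow> real) \<Rightarrow> real^('n::finite) \<Rightarrow> real" where
  "laplacian f x = (\<Sum>i\<in>UNIV. partial_deriv i (partial_deriv i f) x)"

definition harmonic_map_on :: "(real^('n::finite) \<Rightarrow> real^('k::finite)) \<Rightarrow> (real^'n) set \<Rightarrow> bool" where
  "harmonic_map_on F S \<longleftrightarrow>
     (\<forall>k. C2_on (\<lambda>x. F x $ k) S \<and> (\<forall>x\<in>S. laplacian (\<lambda>x. F x $ k) x = 0))"


subsection \<open>Normalized surface measure on the unit sphere\<close>

text \<open>
  Surface measure is defined by integration in polar coordinates: the surface area of a Borel
  subset \<open>A\<close> of the unit sphere in dimension \<open>n\<close> is \<open>n\<close> times the volume of the cone
  \<open>{t \<omega> | \<omega> \<in> A, 0 < t < 1}\<close>. Normalizing the total mass to 1, this is the volume of the cone divided by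
  the volume of the unit ball, i.e. the push-forward of the uniform distribution on the unit
  ball under \<open>x \<mapsto> x / |x|\<close> (which is \<open>sgn\<close>; \<open>sgn 0 = 0\<close> only concerns a null set).
\<close>

definition sphere_measure :: "(real^('n::finite)) measure" where
  "sphere_measure =
     restrict_space (distr (uniform_measure lborel (ball 0 1)) borel sgn) (sphere 0 1)"

lemma space_sphere_measure [simp]: "space sphere_measure = sphere 0 1"
  by (simp add: sphere_measure_def space_restrict_space)

lemma sgn_borel_measurable [measurable]:
  "(sgn :: real^'n \<Rightarrow> real^('n::finite)) \<in> borel_measurable borel"
  unfolding sgn_div_norm by measurable

lemma emeasure_sphere_measure:
  fixes A :: "(real^('n::finite)) set"
  assumes "A \<in> sets borel" "A \<subseteq> sphere 0 1"
  shows "emeasure sphere_measure A =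
    emeasure lborel {x \<in> ball 0 1. sgn x \<in> A} / emeasure lborel (ball (0::real^('n::finite)) 1)"
proof -
  have sp: "sphere (0::real^'n) 1 \<in> sets borel" by simp
  have "emeasure sphere_measure A =
      emeasure (distr (uniform_measure lborel (ball 0 1)) borel sgn) A"
    unfolding sphere_measure_def using assms sp by (subst emeasure_restrict_space) auto
  also have "\<dots> = emeasure (uniform_measure lborel (ball 0 1)) (sgn -` A)"
    using assms measurable_sets[OF sgn_borel_measurable]
    by (subst emeasure_distr) (auto simp: measurable_def)
  also have "\<dots> = emeasure lborel (ball 0 1 \<inter> sgn -` A) / emeasure lborel (ball (0::real^'n) 1)"
    using measurable_sets[OF sgn_borel_measurable assms(1)]
    by (subst emeasure_uniform_measure) auto
  finally show ?thesis
    by (simp add: vimage_def Int_def conj_commute)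
qed

lemma emeasure_sphere_measure_space:
  "emeasure sphere_measure (sphere (0::real^('n::finite)) 1) = 1"
proof -
  let ?B = "ball (0::real^'n) 1"
  have "{x \<in> ?B. sgn x \<in> sphere 0 1} = ?B - {0}"
    by (auto simp: norm_sgn)
  hence "emeasure sphere_measure (sphere (0::real^'n) 1) =
      emeasure lborel (?B - {0}) / emeasure lborel ?B"
    by (simp only: emeasure_sphere_measure[OF borel_closed[OF closed_sphere] subset_refl])
  also have "emeasure lborel (?B - {0}) = emeasure lborel ?B"
    by (rule emeasure_Diff_null_set) auto
  also have "emeasure lborel ?B / emeasure lborel ?B = 1"
  proof (rule ennreal_divide_self)
    show "emeasure lborel ?B \<noteq> 0"
      using content_ball_pos[of 1 "0::real^'n"] by (auto simp: measure_def)
    show "emeasure lborel ?B < top"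
      using emeasure_lborel_ball_finite[of "0::real^'n" 1] by (simp add: top.not_eq_extremum)
  qed
  finally show ?thesis .
qed


subsection \<open>The extremal mappings\<close>

text \<open>
  Functions modulo null sets are represented by Borel functions on the sphere. On a
  (null) set where \<open>norm (u \<omega>) > 1\<close>, the library's \<open>sqrt\<close> takes a negative value, without any
  effect on the integrals.
\<close>

definition extremal_class :: "real^'m \<Rightarrow> real \<Rightarrow> (real^('n::finite) \<Rightarrow> real^('m::finite)) set" where
  "extremal_class a b = {u. u \<in> borel_measurable sphere_measure \<and>
     (AE \<omega> in sphere_measure. norm (u \<omega>) \<le> 1) \<and>
     (LINT \<omega>|sphere_measure. u \<omega>) = a \<and>
     (LINT \<omega>|sphere_measure. sqrt (1 - (norm (u \<omega>))\<^sup>2)) \<ge> b}"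

definition extremal_functional ::
    "real \<Rightarrow> (real^('n::{finite,linorder}) \<Rightarrow> real^('m::{finite,linorder})) \<Rightarrow> real" where
  "extremal_functional r u =
     (LINT \<omega>|sphere_measure.
        (1 - r\<^sup>2) / norm (r *\<^sub>R north_pole - \<omega>) ^ CARD('n) * (u \<omega> \<bullet> first_axis))"

text \<open>
  For \<open>b \<ge> 0\<close>, \<open>|a|\<^sup>2 + b\<^sup>2 < 1\<close> and \<open>0 < r < 1\<close> a maximizer exists and is unique up to a.e. equality.
  \<open>arg_max_on\<close> picks a representative; the Poisson integrals below do not depend on it.
\<close>

definition extremal_fun ::
    "real^('m::{finite,linorder}) \<Rightarrow> real \<Rightarrow> real \<Rightarrow>
     real^('n::{finite,linorder}) \<Rightarrow> real^('m::{finite,linorder})" where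
  "extremal_fun a b r = arg_max_on (extremal_functional r) (extremal_class a b)"

definition poisson_integral ::
    "(real^'n \<Rightarrow> 'b::{banach,second_countable_topology}) \<Rightarrow> real^('n::finite) \<Rightarrow> 'b" where
  "poisson_integral g x =
     (LINT \<omega>|sphere_measure. ((1 - (norm x)\<^sup>2) / norm (x - \<omega>) ^ CARD('n)) *\<^sub>R g \<omega>)"

definition extremal_U ::
    "real^('m::{finite,linorder}) \<Rightarrow> real \<Rightarrow> real \<Rightarrow>
     real^('n::{finite,linorder}) \<Rightarrow> real^('m::{finite,linorder})" where
  "extremal_U a b r =
     (if b \<ge> 0 then poisson_integral (extremal_fun a b r)
      else poisson_integral (extremal_fun a (- b) r))"

definition extremal_V ::
    "real^('m::{finite,linorder}) \<Rightarrow> real \<Rightarrow> real \<Rightarrow>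
     real^('n::{finite,linorder}) \<Rightarrow> real" where
  "extremal_V a b r x =
     (if b \<ge> 0 then poisson_integral (\<lambda>\<omega>. sqrt (1 - (norm (extremal_fun a b r \<omega>))\<^sup>2)) x
      else - poisson_integral (\<lambda>\<omega>. sqrt (1 - (norm (extremal_fun a (- b) r \<omega>))\<^sup>2)) x)"

definition extremal_map ::
    "real^('m::{finite,linorder}) \<Rightarrow> real \<Rightarrow> real \<Rightarrow>
     real^('n::{finite,linorder}) \<Rightarrow> real^('m::{finite,linorder} + 1)" where
  "extremal_map a b r x = vec_pair (extremal_U a b r x) (extremal_V a b r x)"


subsection \<open>The intersection of half-spaces\<close>

text \<open>
  Vectors are row vectors, so matrices act by \<open>v*\<close>. The argument \<open>TYPE('n)\<close> carries the dimension
  of the domain of the extremal mappings.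
\<close>

definition extremal_halfspace ::
    "('n::{finite,linorder}) itself \<Rightarrow>
     (real^('m::{finite,linorder} + 1) \<Rightarrow> real^('m::{finite,linorder} + 1)^('m::{finite,linorder} + 1)) \<Rightarrow>
     real \<Rightarrow> real^('m::{finite,linorder} + 1) \<Rightarrow> real^('m::{finite,linorder} + 1) \<Rightarrow> (real^('m::{finite,linorder} + 1)) set" where
  "extremal_halfspace _ Q r p e =
     {x. x \<bullet> e \<le> extremal_map (vec_init (p v* Q e)) (vec_last (p v* Q e)) r
                    (r *\<^sub>R (north_pole :: real^('n::{finite,linorder}))) \<bullet> e\<^sub>0}"

definition extremal_region ::
    "('n::{finite,linorder}) itself \<Rightarrow>
     (real^('m::{finite,linorder} + 1) \<Rightarrow> real^('m::{finite,linorder} + 1)^('m::{finite,linorder} + 1)) \<Rightarrow>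
     real \<Rightarrow> real^('m::{finite,linorder} + 1) \<Rightarrow> (real^('m::{finite,linorder} + 1)) set" where
  "extremal_region T Q r p = (\<Inter>e\<in>{e. norm e = 1}. extremal_halfspace T Q r p e)"

end

theory Submission
  imports Defs "HOL-Probability.Probability_Measure"
begin

text \<open>
  For \<open>\<rho> < 1\<close> and an orthogonal \<open>T\<close> with \<open>T (r N) = x\<close>, the Poisson formula writes \<open>F (\<rho> x)\<close> as
  the integral of \<open>F (\<rho> T \<omega>)\<close> against the Poisson kernel at \<open>r N\<close>. After rotating the target by \<open>Q\<^sub>e\<close>, the
  first \<open>m\<close> components of \<open>F (\<rho> T \<omega>)\<close> belong to the extremal class, because the last one is dominated by
  \<open>sqrt (1 - |u|\<^sup>2)\<close>. Hence \<open>\<langle>F (\<rho> x), e\<rangle>\<close> is at most the maximum of the extremal functional. Letting \<open>\<rho>\<close>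
  tend to \<open>1\<close> gives the claim for \<open>|x| = r\<close>, and the maximum principle gives it inside. That the maximum is
  attained follows from a finite-dimensional dual problem.
\<close>

subsection \<open>Surface measure\<close>

text \<open>Pairing with \<open>e\<^sub>0\<close> picks out the first coordinate of
  \<open>extremal_U\<close>, in which \<open>b\<close> enters as \<open>\<bar>b\<bar>\<close>; both
  signs of the last coordinate after a rotation are therefore handled by one class. Since
  \<open>extremal_fun\<close> is defined by choice, its value carries information only once some
  maximizer has been exhibited; from then on its membership in the class and its maximality enter
  the estimate. Two hypotheses shape the dual problem. The strict bound on the norm of
  \<open>F 0\<close> makes its objective coercive. Dimension at least 2 makes every level set of the
  kernel at \<open>r N\<close> a null set, so that the norm can be differentiated under the integral
  almost everywhere. The harmonicity hypothesis provides partial derivatives along the axes; these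
  control second differences along the axes, which are exactly what the maximum principle consumes.
  That principle in turn serves three times: for the total mass of the kernel, for the Poisson
  formula, and for the passage from the sphere of radius \<open>r\<close> to the ball.\<close>

text \<open>By Vitali's covering theorem \<open>U\<close> is, up to a null set, a countable disjoint
  union of balls; the preimage of a ball is a ball of the same radius, hence of the same volume.
  Only an inequality results, as the preimage of the null remainder is not yet known to be
  null.\<close>

lemma emeasure_lborel_orthogonal_vimage_open:
  fixes T :: "'a::euclidean_space \<Rightarrow> 'a"
  assumes T: "orthogonal_transformation T" and U: "open U"
  shows "emeasure lborel U \<le> emeasure lborel (T -` U)"
proof -
  let ?K = "{(a, r). 0 < r \<and> ball a r \<subseteq> U}"
  have cont: "continuous_on A T" for A
    using T by (intro linear_continuous_on linear_conv_bounded_linear[THEN iffD1])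
      (simp add: orthogonal_transformation_linear)
  have vball: "\<exists>b. T -` ball a s = ball b s" for a s
  proof -
    obtain b where "a = T b"
      using orthogonal_transformation_surj[OF T] by (metis surjD)
    moreover have "dist (T b) (T x) = dist b x" for x
      using T by (simp add: dist_norm orthogonal_transformation flip: linear_diff)
    ultimately show ?thesis
      by (intro exI[of _ b]) auto
  qed
  have "\<exists>i. i \<in> ?K \<and> x \<in> ball (fst i) (snd i) \<and> snd i < d" if "x \<in> U" "0 < d" for x d
  proof -
    obtain k where "k > 0" "ball x k \<subseteq> U"
      using U \<open>x \<in> U\<close> open_contains_ball by blast
    then have "(x, min k (d / 2)) \<in> ?K"
      using \<open>0 < d\<close> by (auto simp: subset_iff)
    then show ?thesis
      using \<open>0 < d\<close> \<open>k > 0\<close> by (intro exI[of _ "(x, min k (d / 2))"]) auto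
  qed
  then obtain C where C: "countable C" "C \<subseteq> ?K"
      "pairwise (\<lambda>i j. disjnt (ball (fst i) (snd i)) (ball (fst j) (snd j))) C"
      "negligible (U - (\<Union>i\<in>C. ball (fst i) (snd i)))"
    by (rule Vitali_covering_theorem_balls)
  let ?V = "\<Union>i\<in>C. ball (fst i) (snd i)"
  have disj: "disjoint_family_on (\<lambda>i. ball (fst i) (snd i)) C"
    using C(3) by (auto simp: disjoint_family_on_def pairwise_def disjnt_def)
  have "?V \<subseteq> U"
    using C(2) by force
  have "open ?V"
    by (intro open_UN) auto
  then have bU: "U \<in> sets borel" "?V \<in> sets borel"
    using U by (simp_all add: borel_open)
  have "U - ?V \<in> null_sets lborel"
    using C(4) bU by (subst null_sets_completion_iff[symmetric]) (auto simp: negligible_iff_null_sets)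
  then have "emeasure lborel U = emeasure lborel (U - (U - ?V))"
    using bU by (subst emeasure_Diff_null_set) auto
  also have "U - (U - ?V) = ?V"
    using \<open>?V \<subseteq> U\<close> by auto
  also have "emeasure lborel ?V = (\<integral>\<^sup>+i. emeasure lborel (ball (fst i) (snd i)) \<partial>count_space C)"
    using C(1) disj by (intro emeasure_UN_countable) auto
  also have "\<dots> = (\<integral>\<^sup>+i. emeasure lborel (T -` ball (fst i) (snd i)) \<partial>count_space C)"
  proof (intro nn_integral_cong)
    fix i
    obtain b where "T -` ball (fst i) (snd i) = ball b (snd i)"
      using vball by blast
    then show "emeasure lborel (ball (fst i) (snd i)) = emeasure lborel (T -` ball (fst i) (snd i))"
      by (cases "snd i \<ge> 0") (auto simp: emeasure_ball ball_empty)
  qed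
  also have "\<dots> = emeasure lborel (\<Union>i\<in>C. T -` ball (fst i) (snd i))"
  proof (intro emeasure_UN_countable[symmetric])
    show "disjoint_family_on (\<lambda>i. T -` ball (fst i) (snd i)) C"
      using disj unfolding disjoint_family_on_def by blast
    show "T -` ball (fst i) (snd i) \<in> sets lborel" for i
      using vball[of "fst i" "snd i"] by auto
  qed (use C(1) in auto)
  also have "\<dots> \<le> emeasure lborel (T -` U)"
    using \<open>?V \<subseteq> U\<close> U cont by (intro emeasure_mono) (auto intro!: borel_open open_vimage)
  finally show ?thesis .
qed

lemma orthogonal_transformation_borel:
  fixes T :: "'a::euclidean_space \<Rightarrow> 'a"
  assumes "orthogonal_transformation T"
  shows "T \<in> borel_measurable borel"
  using assms by (intro borel_measurable_continuous_onI linear_continuous_on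
      linear_conv_bounded_linear[THEN iffD1]) (simp add: orthogonal_transformation_linear)

text \<open>The inequality for open sets, used for \<open>T\<close> and for its inverse, becomes an
  equality on the open sets, an intersection-stable generator of the Borel sets.\<close>

lemma lborel_distr_orthogonal:
  fixes T :: "'a::euclidean_space \<Rightarrow> 'a"
  assumes T: "orthogonal_transformation T"
  shows "distr lborel borel T = lborel"
proof (rule measure_eqI_generator_eq[where E="{S. open S}" and \<Omega>=UNIV and A="\<lambda>i::nat. ball 0 (real i)"])
  have Tm: "T \<in> borel_measurable borel"
    using T by (rule orthogonal_transformation_borel)
  have T': "orthogonal_transformation (inv T)"
    using T by (rule orthogonal_transformation_inv)
  have inv: "inv T -` T -` X = X" for X
    using orthogonal_transformation_surj[OF T] by (auto simp: surj_f_inv_f)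
  have cont: "continuous_on UNIV T"
    using T by (intro linear_continuous_on linear_conv_bounded_linear[THEN iffD1])
      (simp add: orthogonal_transformation_linear)
  have eq: "emeasure (distr lborel borel T) X = emeasure lborel X" if "open X" for X
  proof -
    have "emeasure (distr lborel borel T) X = emeasure lborel (T -` X)"
      using Tm that by (subst emeasure_distr) auto
    moreover have "open (T -` X)"
      using cont that by (simp add: open_vimage)
    then have "emeasure lborel (T -` X) \<le> emeasure lborel X"
      using emeasure_lborel_orthogonal_vimage_open[OF T', of "T -` X"] by (simp add: inv)
    ultimately show ?thesis
      using emeasure_lborel_orthogonal_vimage_open[OF T that] by auto
  qed
  then show "emeasure (distr lborel borel T) X = emeasure lborel X" if "X \<in> {S. open S}" for X
    using that by auto
  show "emeasure (distr lborel borel T) (ball 0 (real i)) \<noteq> \<infinity>" for i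
    using emeasure_lborel_ball_finite[of "0::'a" "real i"] by (subst eq) auto
  show "(\<Union>i. ball (0::'a) (real i)) = UNIV"
    using reals_Archimedean2 by auto
qed (auto simp: Int_stable_def borel_def)

section \<open>Integration on the sphere and its rotation invariance\<close>

lemma sets_sphere_measure [measurable_cong]:
  "sets (sphere_measure :: (real^('n::finite)) measure) = sets (restrict_space borel (sphere 0 1))"
  by (simp add: sphere_measure_def sets_restrict_space)

lemma in_sets_sphere_measure:
  "A \<in> sets (sphere_measure :: (real^('n::finite)) measure) \<longleftrightarrow> A \<in> sets borel \<and> A \<subseteq> sphere 0 1"
  by (auto simp: sets_sphere_measure sets_restrict_space_iff)

lemma prob_space_sphere_measure: "prob_space (sphere_measure :: (real^('n::finite)) measure)"
  by (rule prob_spaceI) (simp add: emeasure_sphere_measure_space)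

interpretation sphere: prob_space "sphere_measure :: (real^('n::finite)) measure"
  by (rule prob_space_sphere_measure)

lemma continuous_on_sphere_measurable:
  fixes f :: "real^('n::finite) \<Rightarrow> 'b::topological_space"
  assumes "continuous_on (sphere 0 1) f"
  shows "f \<in> borel_measurable sphere_measure"
  using borel_measurable_continuous_on_restrict[OF assms]
  by (simp add: measurable_cong_sets[OF sets_sphere_measure refl])

lemma continuous_on_sphere_integrable:
  fixes f :: "real^('n::finite) \<Rightarrow> 'b::{banach,second_countable_topology}"
  assumes "continuous_on (sphere 0 1) f"
  shows "integrable sphere_measure f"
proof -
  have "bounded (f ` sphere 0 1)"
    using assms by (intro compact_imp_bounded compact_continuous_image) auto
  then obtain B where "\<forall>x\<in>sphere 0 1. norm (f x) \<le> B"
    unfolding bounded_iff by blast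
  then show ?thesis
    by (intro sphere.integrable_const_bound[where B=B] AE_I2 continuous_on_sphere_measurable assms) auto
qed

lemma distr_sphere_measure_orthogonal:
  fixes T :: "real^('n::finite) \<Rightarrow> real^'n"
  assumes T: "orthogonal_transformation T"
  shows "T \<in> measurable sphere_measure sphere_measure"
    and "distr sphere_measure sphere_measure T = sphere_measure"
proof -
  have [measurable]: "T \<in> borel_measurable borel"
    using T by (rule orthogonal_transformation_borel)
  have norm_T: "norm (T x) = norm x" for x
    using T by (rule orthogonal_transformation_norm)
  have sgn_T: "sgn (T x) = T (sgn x)" for x
    using T by (simp add: sgn_div_norm norm_T orthogonal_transformation_scaleR)
  show meas: "T \<in> measurable sphere_measure sphere_measure"
    unfolding measurable_cong_sets[OF sets_sphere_measure sets_sphere_measure]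
    by (intro measurable_restrict_space3) (auto simp: norm_T)
  show "distr sphere_measure sphere_measure T = sphere_measure"
  proof (rule measure_eqI)
    fix A assume "A \<in> sets (distr sphere_measure sphere_measure T)"
    then have A: "A \<in> sets borel" "A \<subseteq> sphere 0 1"
      by (auto simp: in_sets_sphere_measure)
    let ?B = "{x \<in> ball 0 1. sgn x \<in> A}"
    have B: "?B \<in> sets borel"
    proof -
      have "?B = ball 0 1 \<inter> sgn -` A"
        by auto
      then show ?thesis
        using measurable_sets[OF sgn_borel_measurable A(1)] by (auto intro!: sets.Int)
    qed
    have TA: "T -` A \<inter> sphere 0 1 = T -` A"
      using A(2) by (auto simp: norm_T)
    have TAb: "T -` A \<in> sets borel"
      using measurable_sets[OF \<open>T \<in> borel_measurable borel\<close> A(1)] by simp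
    have "emeasure (distr sphere_measure sphere_measure T) A = emeasure sphere_measure (T -` A)"
      using A meas by (subst emeasure_distr) (auto simp: in_sets_sphere_measure TA)
    also have "\<dots> = emeasure lborel {x \<in> ball 0 1. sgn x \<in> T -` A} / emeasure lborel (ball (0::real^'n) 1)"
      using TAb TA by (intro emeasure_sphere_measure) auto
    also have "{x \<in> ball 0 1. sgn x \<in> T -` A} = T -` ?B \<inter> space lborel"
      by (auto simp: sgn_T norm_T)
    also have "emeasure lborel (T -` ?B \<inter> space lborel) = emeasure (distr lborel borel T) ?B"
      using B by (subst emeasure_distr) auto
    also have "\<dots> = emeasure lborel ?B"
      by (simp add: lborel_distr_orthogonal[OF T])
    also have "emeasure lborel ?B / emeasure lborel (ball (0::real^'n) 1) = emeasure sphere_measure A"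
      using A by (intro emeasure_sphere_measure[symmetric])
    finally show "emeasure (distr sphere_measure sphere_measure T) A = emeasure sphere_measure A" .
  qed simp
qed

lemma integral_sphere_measure_orthogonal:
  fixes T :: "real^('n::finite) \<Rightarrow> real^'n" and f :: "real^'n \<Rightarrow> 'b::{banach,second_countable_topology}"
  assumes T: "orthogonal_transformation T" and f: "f \<in> borel_measurable sphere_measure"
  shows "(LINT \<omega>|sphere_measure. f (T \<omega>)) = (LINT \<omega>|sphere_measure. f \<omega>)"
  using integral_distr[OF distr_sphere_measure_orthogonal(1)[OF T] f]
  by (simp add: distr_sphere_measure_orthogonal(2)[OF T])

text \<open>
  The cone is starlike about \<open>p\<close>: on a ray from there, the concave function \<open>x \<bullet> p - t * norm x\<close>
  starts with a positive value, so it has at most one zero.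
\<close>

lemma negligible_cone:
  fixes p :: "'a::euclidean_space"
  assumes p: "norm p = 1" and t: "0 \<le> t" "t < 1"
  shows "negligible {x. x \<bullet> p = t * norm x}"
proof (rule starlike_negligible[where a=p])
  show "closed {x. x \<bullet> p = t * norm x}"
    by (intro closed_Collect_eq continuous_intros)
  have pp: "p \<bullet> p = 1"
    using p by (simp add: dot_square_norm)
  have aux: False if c: "0 \<le> c" "c < 1" and z: "(p + c *\<^sub>R x) \<bullet> p = t * norm (p + c *\<^sub>R x)"
      "(p + x) \<bullet> p = t * norm (p + x)" for c x
  proof -
    have "p + c *\<^sub>R x = (1 - c) *\<^sub>R p + c *\<^sub>R (p + x)"
      by (simp add: algebra_simps)
    then have "norm (p + c *\<^sub>R x) \<le> (1 - c) + c * norm (p + x)"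
      using norm_triangle_ineq[of "(1 - c) *\<^sub>R p" "c *\<^sub>R (p + x)"] p c by auto
    then have "t * norm (p + c *\<^sub>R x) \<le> t * ((1 - c) + c * norm (p + x))"
      using t by (intro mult_left_mono) auto
    also have "\<dots> = t * (1 - c) + c * ((p + x) \<bullet> p)"
      unfolding z(2) by (simp add: algebra_simps)
    also have "\<dots> < (1 - c) + c * ((p + x) \<bullet> p)"
      using t c by simp
    also have "\<dots> = (p + c *\<^sub>R x) \<bullet> p"
      by (simp add: inner_add_left pp algebra_simps)
    finally show False
      using z(1) by simp
  qed
  fix c x
  assume h: "p + c *\<^sub>R x \<in> {x. x \<bullet> p = t * norm x}" "0 \<le> c" "p + x \<in> {x. x \<bullet> p = t * norm x}"
  have "\<not> c < 1"
    using aux[of c x] h by auto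
  \<comment> \<open>A value \<open>c > 1\<close> is reduced to \<open>1 / c < 1\<close> by
    exchanging the two points on the ray.\<close>
  moreover have "\<not> 1 < c"
    using aux[of "1 / c" "c *\<^sub>R x"] h by auto
  ultimately show "c = 1"
    by simp
qed

text \<open>The cone over the slice lies in \<open>x \<bullet> p = t * norm x\<close>. For
  \<open>\<bar>t\<bar> < 1\<close> this is a negligible cone, after changing the signs of
  \<open>p\<close> and \<open>t\<close> if \<open>t < 0\<close>. For
  \<open>\<bar>t\<bar> \<ge> 1\<close> the Cauchy-Schwarz inequality confines the set to the line
  through \<open>p\<close>, which lies in a hyperplane because some \<open>q \<noteq> 0\<close> is
  orthogonal to \<open>p\<close>; this is where the dimension enters.\<close>

lemma AE_sphere_inner_neq:
  fixes p :: "real^('n::finite)"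
  assumes n: "CARD('n) \<ge> 2" and p: "norm p = 1"
  shows "AE \<omega> in sphere_measure. \<omega> \<bullet> p \<noteq> t"
proof -
  let ?A = "{\<omega> \<in> sphere 0 1. \<omega> \<bullet> p = t}"
  let ?N = "{x. x \<bullet> p = t * norm x}"
  have A: "?A \<in> sets borel" "?A \<subseteq> sphere 0 1"
  proof -
    have "?A = {\<omega>. \<omega> \<bullet> p = t} \<inter> sphere 0 1"
      by auto
    also have "closed \<dots>"
      by (intro closed_Int closed_Collect_eq continuous_intros) auto
    finally show "?A \<in> sets borel"
      by (rule borel_closed)
  qed auto
  have "negligible ?N"
  proof (cases "\<bar>t\<bar> < 1")
    case True
    show ?thesis
    proof (cases "t \<ge> 0")
      case True
      then show ?thesis
        using negligible_cone[OF p] \<open>\<bar>t\<bar> < 1\<close> by auto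
    next
      case False
      have "?N = {x. x \<bullet> (-p) = (-t) * norm x}"
        by auto
      then show ?thesis
        using negligible_cone[of "-p" "-t"] \<open>\<bar>t\<bar> < 1\<close> False p by auto
    qed
  next
    case False
    have "DIM(real^'n) \<ge> 2"
      using n by simp
    then obtain q where q: "q \<noteq> 0" "orthogonal p q"
      by (rule orthogonal_to_vector_exists[of p])
    have "q \<bullet> x = 0" if "x \<bullet> p = t * norm x" for x
    proof -
      have "\<bar>x \<bullet> p\<bar> \<le> norm x"
        using Cauchy_Schwarz_ineq2[of x p] p by simp
      moreover have "norm x \<le> \<bar>t\<bar> * norm x"
        using False by (simp add: mult_le_cancel_right1)
      ultimately have "\<bar>x \<bullet> p\<bar> = norm x * norm p"
        using that p by (simp add: abs_mult)
      then have "norm x *\<^sub>R p = x \<or> norm x *\<^sub>R p = - x"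
        unfolding norm_cauchy_schwarz_abs_eq by (simp add: p)
      then have "x = norm x *\<^sub>R p \<or> x = - (norm x *\<^sub>R p)"
        by force
      then show ?thesis
        using q by (metis inner_minus_right inner_scaleR_right minus_zero mult_zero_right orthogonal_commute orthogonal_def)
    qed
    then have "?N \<subseteq> {x. q \<bullet> x = 0}"
      by auto
    then show ?thesis
      using negligible_hyperplane[of q 0] q negligible_subset by blast
  qed
  moreover have "?N \<in> sets borel"
    by (intro borel_closed closed_Collect_eq continuous_intros)
  ultimately have N: "?N \<in> null_sets lborel"
    by (subst null_sets_completion_iff[symmetric]) (auto simp: negligible_iff_null_sets)
  have "x \<in> ?N" if "sgn x \<in> ?A" for x
    using that by (cases "x = 0") (auto simp: sgn_div_norm field_simps)
  then have "emeasure lborel {x \<in> ball 0 1. sgn x \<in> ?A} \<le> emeasure lborel ?N"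
    using N by (intro emeasure_mono) auto
  then have "emeasure lborel {x \<in> ball 0 1. sgn x \<in> ?A} = 0"
    using N by (simp add: null_setsD1)
  then have "emeasure sphere_measure ?A = 0"
    by (subst emeasure_sphere_measure[OF A]) simp
  then have "?A \<in> null_sets sphere_measure"
    using A by (auto simp: null_sets_def in_sets_sphere_measure)
  then show ?thesis
    by (rule AE_I') auto
qed

subsection \<open>Existence of an extremal function\<close>

text \<open>Away from 0 the norm has gradient \<open>sgn y\<close>. The step runs through a sequence
  to fit dominated convergence.\<close>

lemma norm_difference_quotient_tendsto:
  fixes y h :: "'a::real_inner"
  assumes "y \<noteq> 0"
  shows "(\<lambda>i. (norm (y - inverse (real (Suc i)) *\<^sub>R h) - norm y) / inverse (real (Suc i)))
    \<longlonglongrightarrow> - (sgn y \<bullet> h)"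
proof -
  have "((\<lambda>t. norm (y - t *\<^sub>R h)) has_derivative (\<lambda>t. (- (t *\<^sub>R h)) \<bullet> sgn (y - 0 *\<^sub>R h))) (at (0::real))"
    by (rule has_derivative_compose[where g=norm and f="\<lambda>t. y - t *\<^sub>R h"])
      (use assms in \<open>auto intro!: derivative_eq_intros has_derivative_norm\<close>)
  then have "((\<lambda>t. norm (y - t *\<^sub>R h)) has_real_derivative - (sgn y \<bullet> h)) (at 0)"
    by (rule has_derivative_imp_has_field_derivative) (simp add: inner_commute)
  then have "((\<lambda>t. (norm (y - t *\<^sub>R h) - norm y) / t) \<longlongrightarrow> - (sgn y \<bullet> h)) (at 0)"
    by (simp add: DERIV_def)
  moreover have "filterlim (\<lambda>i. inverse (real (Suc i))) (at 0) sequentially"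
    unfolding filterlim_at using LIMSEQ_inverse_real_of_nat by auto
  ultimately show ?thesis
    by (rule filterlim_compose)
qed

text \<open>
  Lagrangian duality in place of weak compactness: the dual objective
  \<open>z \<mapsto> \<integral> |(\<kappa> l, 0) - z| + \<langle>z, (a, b)\<rangle>\<close> lives on a finite-dimensional space and is coercive
  because \<open>|(a, b)| < 1\<close>. At a minimizer \<open>z\<close> the stationarity condition says that the unit vector field
  \<open>sgn ((\<kappa> l, 0) - z)\<close> has mean \<open>(a, b)\<close>, and its first component is a primal maximizer.
\<close>

lemma (in prob_space) exists_extremal_function:
  fixes \<kappa> :: "'a \<Rightarrow> real" and l a :: "'v::euclidean_space"
  assumes \<kappa>: "integrable M \<kappa>" and level: "\<And>t. AE \<omega> in M. \<kappa> \<omega> \<noteq> t"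
    and l: "l \<noteq> 0" and ab: "norm (a, b) < 1" and b: "0 \<le> b"
  obtains u where "u \<in> borel_measurable M" "AE \<omega> in M. norm (u \<omega>) \<le> 1"
    "(LINT \<omega>|M. u \<omega>) = a" "(LINT \<omega>|M. sqrt (1 - (norm (u \<omega>))\<^sup>2)) = b"
    "\<And>u'. u' \<in> borel_measurable M \<Longrightarrow> AE \<omega> in M. norm (u' \<omega>) \<le> 1 \<Longrightarrow> (LINT \<omega>|M. u' \<omega>) = a \<Longrightarrow>
      b \<le> (LINT \<omega>|M. sqrt (1 - (norm (u' \<omega>))\<^sup>2)) \<Longrightarrow>
      (LINT \<omega>|M. \<kappa> \<omega> * (u' \<omega> \<bullet> l)) \<le> (LINT \<omega>|M. \<kappa> \<omega> * (u \<omega> \<bullet> l))"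
proof -
  \<comment> \<open>For a unit vector \<open>(u, s)\<close> the inner product with \<open>q\<close>
    is the integrand \<open>\<kappa> * (u \<bullet> l)\<close>; the constraint on \<open>s\<close>
    enters through the last coordinate of \<open>c\<close>.\<close>
  define q :: "'a \<Rightarrow> 'v \<times> real" where "q \<omega> = (\<kappa> \<omega> *\<^sub>R l, 0)" for \<omega>
  define c where "c = (a, b)"
  define D where "D z = (LINT \<omega>|M. norm (q \<omega> - z)) + z \<bullet> c" for z
  have c: "norm c < 1"
    using ab by (simp add: c_def)
  have q_eq: "q \<omega> = \<kappa> \<omega> *\<^sub>R (l, 0)" for \<omega>
    by (simp add: q_def)
  have q: "integrable M q"
    unfolding q_eq using \<kappa> by (intro integrable_scaleR_left)
  note [measurable] = borel_measurable_integrable[OF q] borel_measurable_integrable[OF \<kappa>]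
  have qz: "integrable M (\<lambda>\<omega>. q \<omega> - z)" for z
    using q by simp
  note nqz = integrable_norm[OF qz]
  have D_lip: "D z \<le> D w + norm (z - w) * (1 + norm c)" for z w
  proof -
    have "(LINT \<omega>|M. norm (q \<omega> - z)) \<le> (LINT \<omega>|M. norm (q \<omega> - w) + norm (z - w))"
    proof (intro integral_mono nqz Bochner_Integration.integrable_add)
      show "norm (q \<omega> - z) \<le> norm (q \<omega> - w) + norm (z - w)" for \<omega>
        using norm_triangle_ineq4[of "q \<omega> - w" "z - w"] by simp
    qed simp
    also have "\<dots> = (LINT \<omega>|M. norm (q \<omega> - w)) + norm (z - w)"
      using nqz by (simp add: prob_space)
    finally have "(LINT \<omega>|M. norm (q \<omega> - z)) \<le> (LINT \<omega>|M. norm (q \<omega> - w)) + norm (z - w)" .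
    moreover have "z \<bullet> c - w \<bullet> c \<le> norm (z - w) * norm c"
      using norm_cauchy_schwarz[of "z - w" c] by (simp add: inner_diff_left)
    ultimately show ?thesis
      by (simp add: D_def algebra_simps)
  qed
  have "\<bar>D z - D w\<bar> \<le> (1 + norm c) * norm (z - w)" for z w
    using D_lip[of z w] D_lip[of w z] by (simp add: norm_minus_commute algebra_simps)
  then have "(1 + norm c)-lipschitz_on UNIV D"
    by (auto simp: lipschitz_on_def dist_norm)
  then have D_cont: "continuous_on UNIV D"
    by (rule lipschitz_on_continuous_on)
  \<comment> \<open>Here \<open>D 0\<close> is the integral of \<open>norm q\<close>, so the bound
    combines the triangle inequality under the integral with Cauchy-Schwarz for
    \<open>z \<bullet> c\<close>.\<close>
  have D_coercive: "norm z * (1 - norm c) - D 0 \<le> D z" for z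
  proof -
    have "norm z - (LINT \<omega>|M. norm (q \<omega>)) = (LINT \<omega>|M. norm z - norm (q \<omega>))"
      using q by (simp add: prob_space)
    also have "\<dots> \<le> (LINT \<omega>|M. norm (q \<omega> - z))"
    proof (intro integral_mono nqz Bochner_Integration.integrable_diff)
      show "norm z - norm (q \<omega>) \<le> norm (q \<omega> - z)" for \<omega>
        using norm_triangle_ineq2[of z "q \<omega>"] by (simp add: norm_minus_commute)
    qed (use q in simp_all)
    finally have "norm z - D 0 \<le> (LINT \<omega>|M. norm (q \<omega> - z))"
      by (simp add: D_def)
    moreover have "- (norm z * norm c) \<le> z \<bullet> c"
      using Cauchy_Schwarz_ineq2[of z c] by linarith
    ultimately show ?thesis
      by (simp add: D_def algebra_simps)
  qed
  \<comment> \<open>Outside this radius the coercive bound exceeds \<open>D 0\<close>, so the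
    minimum over the ball is global.\<close>
  define R where "R = 2 * D 0 / (1 - norm c)"
  have "D 0 \<ge> 0"
    by (simp add: D_def)
  then have "R \<ge> 0"
    using c by (simp add: R_def)
  then have "\<exists>z\<in>cball 0 R. \<forall>w\<in>cball 0 R. D z \<le> D w"
    by (intro continuous_attains_inf continuous_on_subset[OF D_cont]) auto
  then obtain z where z: "\<And>w. w \<in> cball 0 R \<Longrightarrow> D z \<le> D w"
    by blast
  have z_min: "D z \<le> D w" for w
  proof (cases "norm w \<le> R")
    case False
    then have "R * (1 - norm c) < norm w * (1 - norm c)"
      using c by simp
    moreover have "R * (1 - norm c) = 2 * D 0"
      using c by (simp add: R_def)
    ultimately have "D 0 \<le> D w"
      using D_coercive[of w] by simp
    then show ?thesis
      using z[of 0] \<open>R \<ge> 0\<close> by simp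
  qed (use z in simp)
  \<comment> \<open>If \<open>q \<omega> = z\<close>, pairing the first component with
    \<open>l\<close> determines \<open>\<kappa> \<omega>\<close>; the exceptional set therefore lies
    in one level set of \<open>\<kappa>\<close>.\<close>
  have q_neq: "AE \<omega> in M. q \<omega> \<noteq> z"
    using level[of "(fst z \<bullet> l) / (l \<bullet> l)"]
  proof eventually_elim
    case (elim \<omega>)
    then show ?case
      using l by (auto simp: q_def)
  qed
  define w where "w \<omega> = sgn (q \<omega> - z)" for \<omega>
  have w_m [measurable]: "w \<in> borel_measurable M"
    unfolding w_def sgn_div_norm by measurable
  have nw: "norm (w \<omega>) \<le> 1" for \<omega>
    by (simp add: w_def norm_sgn)
  have w: "integrable M w"
    by (rule integrable_const_bound[where B=1]) (use nw in auto)
  \<comment> \<open>The difference quotients of \<open>D\<close> from the minimizer in direction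
    \<open>h\<close> are nonnegative. Since the norm is 1-Lipschitz, \<open>norm h\<close> dominates
    the integrands and the limit may be taken inside.\<close>
  have stationary: "0 \<le> h \<bullet> (c - (LINT \<omega>|M. w \<omega>))" for h
  proof -
    let ?t = "\<lambda>i. inverse (real (Suc i))"
    let ?s = "\<lambda>i \<omega>. (norm ((q \<omega> - z) - ?t i *\<^sub>R h) - norm (q \<omega> - z)) / ?t i"
    have lim: "(\<lambda>i. LINT \<omega>|M. ?s i \<omega>) \<longlonglongrightarrow> (LINT \<omega>|M. - (w \<omega> \<bullet> h))"
    proof (rule integral_dominated_convergence[where w="\<lambda>_. norm h"])
      show "AE \<omega> in M. (\<lambda>i. ?s i \<omega>) \<longlonglongrightarrow> - (w \<omega> \<bullet> h)"
        using q_neq by eventually_elim (simp only: w_def, intro norm_difference_quotient_tendsto, simp)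
      show "AE \<omega> in M. norm (?s i \<omega>) \<le> norm h" for i
      proof (rule AE_I2)
        fix \<omega>
        have "\<bar>norm ((q \<omega> - z) - ?t i *\<^sub>R h) - norm (q \<omega> - z)\<bar> \<le> norm (?t i *\<^sub>R h)"
          using norm_triangle_ineq3[of "(q \<omega> - z) - ?t i *\<^sub>R h" "q \<omega> - z"] by simp
        then have "norm (?s i \<omega>) \<le> norm (?t i *\<^sub>R h) / ?t i"
          unfolding real_norm_def abs_divide by (intro frac_le) (auto simp del: of_nat_Suc)
        then show "norm (?s i \<omega>) \<le> norm h"
          by (simp del: of_nat_Suc)
      qed
    qed auto
    have "0 \<le> (LINT \<omega>|M. ?s i \<omega>) + h \<bullet> c" for i
    proof -
      have "(LINT \<omega>|M. ?s i \<omega>) = ((LINT \<omega>|M. norm (q \<omega> - (z + ?t i *\<^sub>R h))) - (LINT \<omega>|M. norm (q \<omega> - z))) / ?t i"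
        by (subst Bochner_Integration.integral_diff[symmetric])
          (use nqz in \<open>auto simp: algebra_simps simp del: of_nat_Suc\<close>)
      moreover have "D z \<le> D (z + ?t i *\<^sub>R h)"
        by (rule z_min)
      then have "0 \<le> ((LINT \<omega>|M. norm (q \<omega> - (z + ?t i *\<^sub>R h))) - (LINT \<omega>|M. norm (q \<omega> - z))) + ?t i * (h \<bullet> c)"
        by (simp add: D_def inner_add_left)
      then have "0 \<le> (((LINT \<omega>|M. norm (q \<omega> - (z + ?t i *\<^sub>R h))) - (LINT \<omega>|M. norm (q \<omega> - z))) + ?t i * (h \<bullet> c)) / ?t i"
        by (intro divide_nonneg_pos) auto
      ultimately show ?thesis
        by (simp add: add_divide_distrib del: of_nat_Suc)
    qed
    then have "0 \<le> (LINT \<omega>|M. - (w \<omega> \<bullet> h)) + h \<bullet> c"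
      by (intro LIMSEQ_le_const[OF tendsto_add[OF lim tendsto_const]]) auto
    also have "(LINT \<omega>|M. - (w \<omega> \<bullet> h)) = - ((LINT \<omega>|M. w \<omega>) \<bullet> h)"
      using w by (cases "h = 0") auto
    finally show ?thesis
      by (simp add: inner_diff_right inner_commute)
  qed
  \<comment> \<open>Taking \<open>h\<close> to be the negative of the defect itself turns
    stationarity into a nonnegative value of minus its squared norm.\<close>
  have "c - (LINT \<omega>|M. w \<omega>) = 0"
    using stationary[of "- (c - (LINT \<omega>|M. w \<omega>))"]
    by (metis inner_gt_zero_iff inner_minus_left leD neg_0_le_iff_le order_le_less)
  then have w_mean: "(LINT \<omega>|M. w \<omega>) = c"
    by simp
  have w1: "AE \<omega> in M. norm (w \<omega>) = 1"
    using q_neq by eventually_elim (simp add: w_def norm_sgn)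
  define u where "u = (\<lambda>\<omega>. fst (w \<omega>))"
  define s where "s = (\<lambda>\<omega>. snd (w \<omega>))"
  have u: "integrable M u" and u_mean: "(LINT \<omega>|M. u \<omega>) = a"
    unfolding u_def using w integrable_bounded_linear[OF bounded_linear_fst w]
      integral_bounded_linear[OF bounded_linear_fst w] by (auto simp: w_mean c_def)
  have s: "integrable M s" and s_mean: "(LINT \<omega>|M. s \<omega>) = b"
    unfolding s_def using w integrable_bounded_linear[OF bounded_linear_snd w]
      integral_bounded_linear[OF bounded_linear_snd w] by (auto simp: w_mean c_def)
  have s_eq: "s \<omega> = - snd z / norm (q \<omega> - z)" for \<omega>
    by (simp add: s_def w_def sgn_div_norm q_def divide_inverse mult.commute)
  \<comment> \<open>The last coordinate of \<open>q\<close> is 0, so \<open>s\<close> has the sign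
    of \<open>- snd z\<close> throughout. A positive \<open>snd z\<close> would give
    \<open>s\<close> a negative mean, against \<open>b \<ge> 0\<close>. The sign is used twice: to
    identify \<open>s\<close> with the square root, and as the sign of the multiplier of the
    inequality constraint.\<close>
  have snd_z: "snd z \<le> 0"
  proof (rule ccontr)
    assume z_pos: "\<not> snd z \<le> 0"
    have "AE \<omega> in M. s \<omega> < 0"
      using q_neq by eventually_elim (use z_pos in \<open>simp add: s_eq\<close>)
    then have "(LINT \<omega>|M. s \<omega>) < 0"
      using expectation_less[OF s] by blast
    then show False
      using b s_mean by simp
  qed
  have us: "AE \<omega> in M. sqrt (1 - (norm (u \<omega>))\<^sup>2) = s \<omega>"
    using w1
  proof eventually_elim
    case (elim \<omega>)
    then have "(norm (u \<omega>))\<^sup>2 + (s \<omega>)\<^sup>2 = 1"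
      by (simp add: norm_prod_def u_def s_def)
    then have "1 - (norm (u \<omega>))\<^sup>2 = (s \<omega>)\<^sup>2"
      by simp
    moreover have "s \<omega> \<ge> 0"
      using snd_z by (simp add: s_eq divide_nonpos_nonneg)
    ultimately show ?case
      by simp
  qed
  show ?thesis
  proof
    show "u \<in> borel_measurable M"
      using u by simp
    show "AE \<omega> in M. norm (u \<omega>) \<le> 1"
    proof (rule AE_I2)
      fix \<omega>
      show "norm (u \<omega>) \<le> 1"
        using norm_fst_le[of "fst (w \<omega>)" "snd (w \<omega>)"] nw[of \<omega>] by (simp add: u_def)
    qed
    show "(LINT \<omega>|M. u \<omega>) = a"
      by (rule u_mean)
    have "(LINT \<omega>|M. sqrt (1 - (norm (u \<omega>))\<^sup>2)) = (LINT \<omega>|M. s \<omega>)"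
      using us u s by (intro integral_cong_AE) auto
    then show "(LINT \<omega>|M. sqrt (1 - (norm (u \<omega>))\<^sup>2)) = b"
      by (simp add: s_mean)
    fix u' :: "'a \<Rightarrow> 'v"
    assume u'_m [measurable]: "u' \<in> borel_measurable M" and u'_le: "AE \<omega> in M. norm (u' \<omega>) \<le> 1"
      and u'_mean: "(LINT \<omega>|M. u' \<omega>) = a"
      and u'_sqrt: "b \<le> (LINT \<omega>|M. sqrt (1 - (norm (u' \<omega>))\<^sup>2))"
    let ?s' = "\<lambda>\<omega>. sqrt (1 - (norm (u' \<omega>))\<^sup>2)"
    let ?w' = "\<lambda>\<omega>. (u' \<omega>, ?s' \<omega>)"
    have w'1: "AE \<omega> in M. norm (?w' \<omega>) = 1"
      using u'_le
    proof eventually_elim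
      case (elim \<omega>)
      then have "(norm (u' \<omega>))\<^sup>2 \<le> 1"
        by (simp add: power_le_one)
      then show ?case
        by (simp add: norm_prod_def)
    qed
    then have w': "integrable M ?w'"
      by (intro integrable_const_bound[where B=1]) (auto elim!: eventually_mono)
    have inner_int: "integrable M (\<lambda>\<omega>. f \<omega> \<bullet> g \<omega>)"
      if f: "integrable M f" and [measurable]: "g \<in> borel_measurable M" and g: "AE \<omega> in M. norm (g \<omega>) = 1"
      for f g :: "'a \<Rightarrow> 'v \<times> real"
    proof (rule Bochner_Integration.integrable_bound[OF f])
      show "AE \<omega> in M. norm (f \<omega> \<bullet> g \<omega>) \<le> norm (f \<omega>)"
        using g
      proof eventually_elim
        case (elim \<omega>)
        then show ?case
          using Cauchy_Schwarz_ineq2[of "f \<omega>" "g \<omega>"] by simp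
      qed
      show "(\<lambda>\<omega>. f \<omega> \<bullet> g \<omega>) \<in> borel_measurable M"
        using f by measurable
    qed
    have w'_m: "?w' \<in> borel_measurable M"
      using w' by simp
    have split: "(LINT \<omega>|M. q \<omega> \<bullet> g \<omega>) = (LINT \<omega>|M. (q \<omega> - z) \<bullet> g \<omega>) + z \<bullet> (LINT \<omega>|M. g \<omega>)"
      if g: "integrable M g" "AE \<omega> in M. norm (g \<omega>) = 1" for g
    proof -
      have "(LINT \<omega>|M. q \<omega> \<bullet> g \<omega>) = (LINT \<omega>|M. (q \<omega> - z) \<bullet> g \<omega> + z \<bullet> g \<omega>)"
        by (simp add: inner_diff_left)
      also have "\<dots> = (LINT \<omega>|M. (q \<omega> - z) \<bullet> g \<omega>) + (LINT \<omega>|M. z \<bullet> g \<omega>)"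
        using g by (intro Bochner_Integration.integral_add inner_int qz) auto
      also have "(LINT \<omega>|M. z \<bullet> g \<omega>) = z \<bullet> (LINT \<omega>|M. g \<omega>)"
        using g by (cases "z = 0") auto
      finally show ?thesis .
    qed
    \<comment> \<open>Weak duality: any competitor, completed to a unit field, has value at most
      \<open>D z\<close>, the slack in its constraint being absorbed by
      \<open>snd z \<le> 0\<close>. For \<open>w\<close> Cauchy-Schwarz is an equality, so
      \<open>D z\<close> is its value.\<close>
    have "(LINT \<omega>|M. \<kappa> \<omega> * (u' \<omega> \<bullet> l)) = (LINT \<omega>|M. q \<omega> \<bullet> ?w' \<omega>)"
      by (simp add: q_def inner_commute)
    also have "\<dots> = (LINT \<omega>|M. (q \<omega> - z) \<bullet> ?w' \<omega>) + z \<bullet> (LINT \<omega>|M. ?w' \<omega>)"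
      using w' w'1 by (rule split)
    also have "\<dots> \<le> (LINT \<omega>|M. norm (q \<omega> - z)) + z \<bullet> c"
    proof (rule add_mono)
      show "(LINT \<omega>|M. (q \<omega> - z) \<bullet> ?w' \<omega>) \<le> (LINT \<omega>|M. norm (q \<omega> - z))"
      proof (intro integral_mono_AE inner_int qz nqz w'1 w'_m)
        show "AE \<omega> in M. (q \<omega> - z) \<bullet> ?w' \<omega> \<le> norm (q \<omega> - z)"
          using w'1
        proof eventually_elim
          case (elim \<omega>)
          then show ?case
            using norm_cauchy_schwarz[of "q \<omega> - z" "?w' \<omega>"] by simp
        qed
      qed
      have "fst (LINT \<omega>|M. ?w' \<omega>) = a" "snd (LINT \<omega>|M. ?w' \<omega>) \<ge> b"
        using integral_bounded_linear[OF bounded_linear_fst w'] integral_bounded_linear[OF bounded_linear_snd w']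
          u'_mean u'_sqrt by simp_all
      then show "z \<bullet> (LINT \<omega>|M. ?w' \<omega>) \<le> z \<bullet> c"
        using snd_z by (simp add: inner_prod_def c_def mult_left_mono_neg)
    qed
    also have "(LINT \<omega>|M. norm (q \<omega> - z)) = (LINT \<omega>|M. (q \<omega> - z) \<bullet> w \<omega>)"
    proof (intro Bochner_Integration.integral_cong refl)
      show "norm (q \<omega> - z) = (q \<omega> - z) \<bullet> w \<omega>" for \<omega>
        by (cases "q \<omega> = z") (auto simp: w_def sgn_div_norm power2_norm_eq_inner[symmetric] power2_eq_square)
    qed
    also have "\<dots> + z \<bullet> c = (LINT \<omega>|M. q \<omega> \<bullet> w \<omega>)"
      using split[OF w w1] by (simp add: w_mean)
    also have "\<dots> = (LINT \<omega>|M. \<kappa> \<omega> * (u \<omega> \<bullet> l))"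
      by (simp add: q_def u_def inner_prod_def inner_commute)
    finally show "(LINT \<omega>|M. \<kappa> \<omega> * (u' \<omega> \<bullet> l)) \<le> (LINT \<omega>|M. \<kappa> \<omega> * (u \<omega> \<bullet> l))" .
  qed
qed

subsection \<open>Weak harmonicity and the maximum principle\<close>

text \<open>Taylor's formula of order two for the even function \<open>f s + f (- s)\<close>: its
  linear term vanishes by symmetry, and the Lagrange remainder is the average on the right.\<close>

lemma second_difference_mean_value:
  fixes f f' f'' :: "real \<Rightarrow> real"
  assumes t: "0 < t"
    and f': "\<And>s. \<bar>s\<bar> \<le> t \<Longrightarrow> (f has_real_derivative f' s) (at s)"
    and f'': "\<And>s. \<bar>s\<bar> \<le> t \<Longrightarrow> (f' has_real_derivative f'' s) (at s)"
  obtains s where "\<bar>s\<bar> \<le> t" "f t + f (- t) - 2 * f 0 = t\<^sup>2 * ((f'' s + f'' (- s)) / 2)"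
proof -
  define diff where "diff m = (case m of 0 \<Rightarrow> (\<lambda>s. f s + f (- s)) | Suc 0 \<Rightarrow> (\<lambda>s. f' s - f' (- s))
    | _ \<Rightarrow> (\<lambda>s. f'' s + f'' (- s)))" for m :: nat
  have mirror: "((\<lambda>s. g (- s)) has_real_derivative - g' (- s)) (at s)"
    if "\<And>s. \<bar>s\<bar> \<le> t \<Longrightarrow> (g has_real_derivative g' s) (at s)" "\<bar>s\<bar> \<le> t" for g g' s
    using DERIV_chain2[OF that(1)[of "- s"] DERIV_minus[OF DERIV_ident]] that(2) by simp
  have "\<exists>s. 0 < s \<and> s < t \<and>
      f t + f (- t) = (\<Sum>m<2. diff m 0 / fact m * t ^ m) + diff 2 s / fact 2 * t ^ 2"
  proof (rule Maclaurin[OF t])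
    show "diff 0 = (\<lambda>s. f s + f (- s))"
      by (simp add: diff_def)
    show "\<forall>m s. m < 2 \<and> 0 \<le> s \<and> s \<le> t \<longrightarrow> (diff m has_real_derivative diff (Suc m) s) (at s)"
    proof (intro allI impI)
      fix m s
      assume h: "m < (2::nat) \<and> 0 \<le> s \<and> s \<le> t"
      then consider "m = 0" | "m = 1"
        by linarith
      then show "(diff m has_real_derivative diff (Suc m) s) (at s)"
      proof cases
        case 1
        have "((\<lambda>s. f s + f (- s)) has_real_derivative f' s + - f' (- s)) (at s)"
          by (intro DERIV_add f' mirror) (use h in auto)
        then show ?thesis
          by (simp add: 1 diff_def)
      next
        case 2
        have "((\<lambda>s. f' s - f' (- s)) has_real_derivative f'' s - - f'' (- s)) (at s)"
          by (intro DERIV_diff f'' mirror) (use h in auto)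
        then show ?thesis
          by (simp add: 2 diff_def)
      qed
    qed
  qed simp
  then obtain s where "0 < s" "s < t"
      "f t + f (- t) = (\<Sum>m<2. diff m 0 / fact m * t ^ m) + diff 2 s / fact 2 * t ^ 2"
    by blast
  then show ?thesis
    by (intro that[of s]) (auto simp: diff_def numeral_2_eq_2 field_simps)
qed

text \<open>Both points in the mean value form lie within the step size of 0, so continuity of
  \<open>f''\<close> at 0 gives the limit.\<close>

lemma second_difference_quotient_tendsto:
  fixes f f' f'' :: "real \<Rightarrow> real"
  assumes \<delta>: "0 < \<delta>"
    and f': "\<And>s. \<bar>s\<bar> < \<delta> \<Longrightarrow> (f has_real_derivative f' s) (at s)"
    and f'': "\<And>s. \<bar>s\<bar> < \<delta> \<Longrightarrow> (f' has_real_derivative f'' s) (at s)"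
    and cont: "isCont f'' 0"
  shows "(\<lambda>k. (f (inverse (real (Suc k))) + f (- inverse (real (Suc k))) - 2 * f 0) /
    (inverse (real (Suc k)))\<^sup>2) \<longlonglongrightarrow> f'' 0"
proof (rule tendstoI)
  fix e :: real
  assume e: "e > 0"
  then obtain \<eta> where \<eta>: "\<eta> > 0" "\<And>s. \<bar>s\<bar> < \<eta> \<Longrightarrow> \<bar>f'' s - f'' 0\<bar> < e"
    using cont unfolding continuous_at_eps_delta by (auto simp: dist_real_def)
  have "eventually (\<lambda>k. inverse (real (Suc k)) < min \<delta> \<eta>) sequentially"
    using LIMSEQ_inverse_real_of_nat \<delta> \<eta>(1) by (intro order_tendstoD) auto
  then show "eventually (\<lambda>k. dist ((f (inverse (real (Suc k))) + f (- inverse (real (Suc k))) - 2 * f 0) /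
      (inverse (real (Suc k)))\<^sup>2) (f'' 0) < e) sequentially"
  proof eventually_elim
    case (elim k)
    define t where "t = inverse (real (Suc k))"
    have t: "0 < t" "t < \<delta>" "t < \<eta>"
      using elim by (auto simp: t_def simp del: of_nat_Suc)
    obtain s where s: "\<bar>s\<bar> \<le> t" "f t + f (- t) - 2 * f 0 = t\<^sup>2 * ((f'' s + f'' (- s)) / 2)"
      by (rule second_difference_mean_value[OF t(1) f' f'']) (use t in auto)
    have "\<bar>f'' s - f'' 0\<bar> < e" "\<bar>f'' (- s) - f'' 0\<bar> < e"
      using s(1) t by (auto intro!: \<eta>)
    then have "\<bar>(f'' s + f'' (- s)) / 2 - f'' 0\<bar> < e"
      by (simp add: abs_less_iff field_simps)
    then show ?case
      unfolding t_def[symmetric] s(2) using t by (simp add: dist_real_def)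
  qed
qed

text \<open>
  Harmonicity tested by second differences along the axes: for this notion only the values of \<open>f\<close>
  matter, so it passes through integrals by dominated convergence, and it suffices for the maximum principle.
\<close>

definition lap_quotient :: "(real^('n::finite) \<Rightarrow> real) \<Rightarrow> real^'n \<Rightarrow> real \<Rightarrow> real" where
  "lap_quotient f x t = (\<Sum>i\<in>UNIV. f (x + t *\<^sub>R axis i 1) + f (x - t *\<^sub>R axis i 1) - 2 * f x) / t\<^sup>2"

text \<open>The step sizes form a sequence so that dominated convergence applies directly.\<close>

definition weakly_harmonic_at :: "(real^('n::finite) \<Rightarrow> real) \<Rightarrow> real^'n \<Rightarrow> bool" where
  "weakly_harmonic_at f x \<longleftrightarrow> (\<lambda>k. lap_quotient f x (inverse (real (Suc k)))) \<longlonglongrightarrow> 0"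

lemma weakly_harmonic_at_add:
  assumes "weakly_harmonic_at f x" "weakly_harmonic_at g x"
  shows "weakly_harmonic_at (\<lambda>x. f x + g x) x"
proof -
  have "lap_quotient (\<lambda>x. f x + g x) x t = lap_quotient f x t + lap_quotient g x t" for t
    by (simp add: lap_quotient_def sum.distrib[symmetric] algebra_simps flip: add_divide_distrib)
  then show ?thesis
    using tendsto_add[OF assms[unfolded weakly_harmonic_at_def]] by (simp add: weakly_harmonic_at_def)
qed

lemma weakly_harmonic_at_cmult:
  assumes "weakly_harmonic_at f x"
  shows "weakly_harmonic_at (\<lambda>x. c * f x) x"
proof -
  have "lap_quotient (\<lambda>x. c * f x) x t = c * lap_quotient f x t" for t
    by (simp add: lap_quotient_def sum_distrib_left algebra_simps)
  then show ?thesis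
    using tendsto_mult_right_zero[OF assms[unfolded weakly_harmonic_at_def], of c]
    by (simp add: weakly_harmonic_at_def)
qed

lemma weakly_harmonic_at_diff:
  assumes "weakly_harmonic_at f x" "weakly_harmonic_at g x"
  shows "weakly_harmonic_at (\<lambda>x. f x - g x) x"
  using weakly_harmonic_at_add[OF assms(1) weakly_harmonic_at_cmult[OF assms(2), of "-1"]] by simp

lemma weakly_harmonic_at_sum:
  assumes "finite I" "\<And>i. i \<in> I \<Longrightarrow> weakly_harmonic_at (f i) x"
  shows "weakly_harmonic_at (\<lambda>x. \<Sum>i\<in>I. f i x) x"
  using assms
proof (induction I rule: finite_induct)
  case empty
  show ?case
    by (simp add: weakly_harmonic_at_def lap_quotient_def)
next
  case (insert i I)
  then show ?case
    using weakly_harmonic_at_add[of "f i" x "\<lambda>x. \<Sum>i\<in>I. f i x"] by simp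
qed

lemma eventually_inverse_Suc_axis_in_open:
  fixes x :: "real^('n::finite)"
  assumes "open S" "x \<in> S"
  shows "eventually (\<lambda>k. \<forall>i. x + inverse (real (Suc k)) *\<^sub>R axis i 1 \<in> S \<and>
    x - inverse (real (Suc k)) *\<^sub>R axis i 1 \<in> S) sequentially"
proof -
  obtain d where d: "d > 0" "ball x d \<subseteq> S"
    using assms open_contains_ball by blast
  have "eventually (\<lambda>k. inverse (real (Suc k)) < d) sequentially"
    using LIMSEQ_inverse_real_of_nat d(1) by (intro order_tendstoD) auto
  then show ?thesis
  proof eventually_elim
    case (elim k)
    then show ?case
      using d(2) by (auto simp: subset_iff dist_norm simp del: of_nat_Suc)
  qed
qed

text \<open>Adding \<open>\<epsilon> * (norm y)\<^sup>2\<close> makes an interior maximum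
  contradictory: by the parallelogram identity the added term contributes
  \<open>2 * \<epsilon> * t\<^sup>2\<close> to each axis difference, so at a maximum of the sum the
  quotients of \<open>f\<close> stay below a negative constant instead of tending to 0.\<close>

lemma weak_maximum_principle:
  fixes f :: "real^('n::finite) \<Rightarrow> real"
  assumes cont: "continuous_on (cball 0 R) f"
    and harm: "\<And>x. x \<in> ball 0 R \<Longrightarrow> weakly_harmonic_at f x"
    and bd: "\<And>x. norm x = R \<Longrightarrow> f x \<le> M"
    and x: "norm x \<le> R"
  shows "f x \<le> M"
proof (rule ccontr)
  assume less: "\<not> f x \<le> M"
  \<comment> \<open>Small enough that on the sphere the added term,
    \<open>\<epsilon> * R\<^sup>2\<close>, stays below the excess \<open>f x - M\<close>; this keeps
    the maximum of \<open>g\<close> inside.\<close>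
  define \<epsilon> where "\<epsilon> = (f x - M) / (R\<^sup>2 + 1)"
  define g where "g y = f y + \<epsilon> * (norm y)\<^sup>2" for y
  have R1: "R\<^sup>2 + 1 > 0"
    by (simp add: add_nonneg_pos)
  then have \<epsilon>: "\<epsilon> > 0"
    using less by (simp add: \<epsilon>_def)
  have "\<epsilon> * (R\<^sup>2 + 1) = f x - M"
    using R1 by (simp add: \<epsilon>_def)
  then have \<epsilon>R: "M + \<epsilon> * R\<^sup>2 < f x"
    using \<epsilon> by (simp add: algebra_simps)
  have "continuous_on (cball 0 R) g"
    unfolding g_def by (intro continuous_intros cont)
  then have "\<exists>z\<in>cball 0 R. \<forall>y\<in>cball 0 R. g y \<le> g z"
    using order_trans[OF norm_ge_zero x] by (intro continuous_attains_sup) auto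
  then obtain z where z: "z \<in> cball 0 R" "\<And>y. y \<in> cball 0 R \<Longrightarrow> g y \<le> g z"
    by blast
  have "f x \<le> g x"
    using \<epsilon> by (simp add: g_def)
  also have "g x \<le> g z"
    using x by (intro z) simp
  finally have "M + \<epsilon> * R\<^sup>2 < g z"
    using \<epsilon>R by simp
  then have "norm z \<noteq> R"
    using bd[of z] by (auto simp: g_def)
  then have zb: "z \<in> ball 0 R"
    using z(1) by auto
  have "eventually (\<lambda>k. lap_quotient f z (inverse (real (Suc k))) \<le> - 2 * real CARD('n) * \<epsilon>) sequentially"
    using eventually_inverse_Suc_axis_in_open[OF open_ball zb]
  proof eventually_elim
    case (elim k)
    define t where "t = inverse (real (Suc k))"
    have t: "t > 0"
      by (simp add: t_def del: of_nat_Suc)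
    have "(\<Sum>i\<in>UNIV. f (z + t *\<^sub>R axis i 1) + f (z - t *\<^sub>R axis i 1) - 2 * f z) \<le> (\<Sum>i\<in>(UNIV::'n set). - 2 * \<epsilon> * t\<^sup>2)"
    proof (rule sum_mono)
      fix i :: 'n
      have "z + t *\<^sub>R axis i 1 \<in> cball 0 R" "z - t *\<^sub>R axis i 1 \<in> cball 0 R"
        using elim ball_subset_cball unfolding t_def by blast+
      then have "g (z + t *\<^sub>R axis i 1) \<le> g z" "g (z - t *\<^sub>R axis i 1) \<le> g z"
        by (auto intro!: z(2))
      moreover have "(norm (z + t *\<^sub>R axis i 1))\<^sup>2 + (norm (z - t *\<^sub>R axis i 1))\<^sup>2 = 2 * (norm z)\<^sup>2 + 2 * t\<^sup>2"
        unfolding power2_norm_eq_inner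
        by (simp add: inner_add_left inner_add_right inner_diff_left inner_diff_right inner_axis_axis
            power2_eq_square algebra_simps)
      then have "\<epsilon> * (norm (z + t *\<^sub>R axis i 1))\<^sup>2 + \<epsilon> * (norm (z - t *\<^sub>R axis i 1))\<^sup>2 =
          2 * (\<epsilon> * (norm z)\<^sup>2) + 2 * \<epsilon> * t\<^sup>2"
        unfolding distrib_left[symmetric] by (simp add: algebra_simps)
      ultimately show "f (z + t *\<^sub>R axis i 1) + f (z - t *\<^sub>R axis i 1) - 2 * f z \<le> - 2 * \<epsilon> * t\<^sup>2"
        unfolding g_def by linarith
    qed
    also have "\<dots> = (- 2 * real CARD('n) * \<epsilon>) * t\<^sup>2"
      by simp
    finally show ?case
      unfolding lap_quotient_def t_def[symmetric] using t by (subst pos_divide_le_eq) auto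
  qed
  then have "0 \<le> - 2 * real CARD('n) * \<epsilon>"
    by (rule tendsto_upperbound[OF harm[OF zb, unfolded weakly_harmonic_at_def]]) auto
  then show False
    using \<epsilon> by (simp add: mult_le_0_iff zero_less_card_finite)
qed

section \<open>From continuous partial derivatives to weak harmonicity\<close>

text \<open>\<open>C1_on\<close> speaks of the parameter value 0 only; moving the base point along
  the axis reaches every \<open>t\<close>.\<close>

lemma C1_on_has_line_derivative:
  assumes "C1_on f S" "x + t *\<^sub>R axis i 1 \<in> S"
  shows "((\<lambda>t. f (x + t *\<^sub>R axis i 1)) has_real_derivative partial_deriv i f (x + t *\<^sub>R axis i 1)) (at t)"
proof -
  have "(\<lambda>s. f ((x + t *\<^sub>R axis i 1) + s *\<^sub>R axis i 1)) differentiable (at 0)"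
    using assms by (simp add: C1_on_def)
  then have "((\<lambda>s. f (x + (s + t) *\<^sub>R axis i 1)) has_real_derivative partial_deriv i f (x + t *\<^sub>R axis i 1)) (at 0)"
    by (simp add: partial_deriv_def DERIV_deriv_iff_real_differentiable[symmetric] algebra_simps)
  then show ?thesis
    using DERIV_shift[of "\<lambda>t. f (x + t *\<^sub>R axis i 1)" _ 0 t] by simp
qed

text \<open>\<open>C1_on\<close> asserts continuity of the partial derivatives, not of
  \<open>f\<close>. These are bounded on a closed ball, and passing from \<open>x\<close> to
  \<open>y\<close> one coordinate at a time bounds the increment of \<open>f\<close> by the mean
  value inequality on each segment.\<close>

lemma C1_on_imp_continuous_on:
  fixes f :: "real^('n::finite) \<Rightarrow> real"
  assumes S: "open S" and f: "C1_on f S"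
  shows "continuous_on S f"
proof (rule continuous_at_imp_continuous_on, intro ballI)
  fix x
  assume "x \<in> S"
  then obtain e where e: "e > 0" "cball x e \<subseteq> S"
    using S open_contains_cball by blast
  have "\<exists>B. \<forall>y\<in>cball x e. \<bar>partial_deriv i f y\<bar> \<le> B" for i
  proof -
    have "continuous_on (cball x e) (partial_deriv i f)"
      using f e(2) unfolding C1_on_def by (meson continuous_on_subset)
    then have "bounded (partial_deriv i f ` cball x e)"
      by (intro compact_imp_bounded compact_continuous_image) auto
    then show ?thesis
      by (auto simp: bounded_iff)
  qed
  then obtain B where B: "\<And>i y. y \<in> cball x e \<Longrightarrow> \<bar>partial_deriv i f y\<bar> \<le> B i"
    by metis
  have est: "\<bar>f y - f x\<bar> \<le> (\<Sum>i\<in>UNIV. B i * \<bar>(y - x) $ i\<bar>)" if y: "y \<in> cball x e" for y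
  proof -
    \<comment> \<open>\<open>p I\<close> is the intermediate point whose coordinates in
      \<open>I\<close> have already been moved from \<open>x\<close> to \<open>y\<close>.\<close>
    define p where "p I = (\<chi> i. if i \<in> I then y $ i else x $ i)" for I
    have "\<bar>f (p I) - f x\<bar> \<le> (\<Sum>i\<in>I. B i * \<bar>(y - x) $ i\<bar>)" for I
      using finite[of I]
    proof (induction I rule: finite_induct)
      case empty
      show ?case
        by (simp add: p_def)
    next
      case (insert j I)
      define d where "d = (y - x) $ j"
      have pj: "p (insert j I) = p I + d *\<^sub>R axis j 1"
        using insert.hyps by (auto simp: p_def d_def vec_eq_iff axis_def)
      \<comment> \<open>Each coordinate of such a point is no farther from that of \<open>x\<close>
        than the coordinate of \<open>y\<close> is, so the segment stays in the ball.\<close>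
      have seg: "p I + t *\<^sub>R axis j 1 \<in> cball x e" if t: "t \<in> closed_segment 0 d" for t
      proof -
        have "\<bar>t\<bar> \<le> \<bar>d\<bar>"
          using t by (auto simp: closed_segment_eq_real_ivl split: if_splits)
        then have "norm (p I + t *\<^sub>R axis j 1 - x) \<le> norm (y - x)"
          using insert.hyps by (intro norm_le_componentwise_cart) (auto simp: p_def d_def axis_def)
        then show ?thesis
          using y by (simp add: dist_norm norm_minus_commute)
      qed
      have "norm (f (p I + d *\<^sub>R axis j 1) - f (p I + 0 *\<^sub>R axis j 1)) \<le> B j * norm (d - 0)"
      proof (rule field_differentiable_bound[where S="closed_segment 0 d"
            and f="\<lambda>t. f (p I + t *\<^sub>R axis j 1)" and f'="\<lambda>t. partial_deriv j f (p I + t *\<^sub>R axis j 1)"])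
        show "((\<lambda>t. f (p I + t *\<^sub>R axis j 1)) has_real_derivative partial_deriv j f (p I + t *\<^sub>R axis j 1))
            (at t within closed_segment 0 d)" if "t \<in> closed_segment 0 d" for t
          using seg[OF that] e(2)
          by (intro has_field_derivative_at_within[OF C1_on_has_line_derivative[OF f]]) blast
        show "norm (partial_deriv j f (p I + t *\<^sub>R axis j 1)) \<le> B j" if "t \<in> closed_segment 0 d" for t
          using B[OF seg[OF that]] by simp
      qed auto
      then have "\<bar>f (p (insert j I)) - f (p I)\<bar> \<le> B j * \<bar>(y - x) $ j\<bar>"
        by (simp add: pj d_def)
      then show ?case
        using insert by simp
    qed
    from this[of UNIV] show ?thesis
      by (simp add: p_def)
  qed
  have "((\<lambda>y. \<Sum>i\<in>UNIV. B i * \<bar>(y - x) $ i\<bar>) \<longlongrightarrow> (\<Sum>i\<in>UNIV. B i * \<bar>(x - x) $ i\<bar>)) (at x)"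
    by (intro tendsto_intros)
  then have "((\<lambda>y. \<Sum>i\<in>UNIV. B i * \<bar>(y - x) $ i\<bar>) \<longlongrightarrow> 0) (at x)"
    by simp
  moreover have "eventually (\<lambda>y. norm (f y - f x) \<le> (\<Sum>i\<in>UNIV. B i * \<bar>(y - x) $ i\<bar>)) (at x)"
    unfolding eventually_at using e(1) est by (intro exI[of _ e]) (auto simp: dist_commute)
  ultimately have "((\<lambda>y. f y - f x) \<longlongrightarrow> 0) (at x)"
    by (rule Lim_null_comparison[rotated])
  then show "isCont f x"
    by (simp add: isCont_def Lim_null[symmetric])
qed

text \<open>The derivatives are parameters to cover two cases: closed formulas for the Poisson
  kernel, and the chain rule for a dilated function.\<close>

lemma lap_quotient_tendsto_sum:
  fixes f :: "real^('n::finite) \<Rightarrow> real"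
  assumes S: "open S" "x \<in> S"
    and f': "\<And>i t. x + t *\<^sub>R axis i 1 \<in> S \<Longrightarrow>
      ((\<lambda>t. f (x + t *\<^sub>R axis i 1)) has_real_derivative f' i (x + t *\<^sub>R axis i 1)) (at t)"
    and f'': "\<And>i t. x + t *\<^sub>R axis i 1 \<in> S \<Longrightarrow>
      ((\<lambda>t. f' i (x + t *\<^sub>R axis i 1)) has_real_derivative f'' i (x + t *\<^sub>R axis i 1)) (at t)"
    and cont: "\<And>i. continuous_on S (f'' i)"
  shows "(\<lambda>k. lap_quotient f x (inverse (real (Suc k)))) \<longlonglongrightarrow> (\<Sum>i\<in>UNIV. f'' i x)"
proof -
  obtain d where d: "d > 0" "ball x d \<subseteq> S"
    using S open_contains_ball by blast
  have in_S: "x + t *\<^sub>R axis i 1 \<in> S" if "\<bar>t\<bar> < d" for t and i :: 'n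
    using d that by (auto simp: subset_iff dist_norm)
  have "(\<lambda>k. (f (x + inverse (real (Suc k)) *\<^sub>R axis i 1) + f (x + (- inverse (real (Suc k))) *\<^sub>R axis i 1)
      - 2 * f (x + 0 *\<^sub>R axis i 1)) / (inverse (real (Suc k)))\<^sup>2) \<longlonglongrightarrow> f'' i (x + 0 *\<^sub>R axis i 1)" for i
  proof (rule second_difference_quotient_tendsto[where f="\<lambda>t. f (x + t *\<^sub>R axis i 1)"
        and f'="\<lambda>t. f' i (x + t *\<^sub>R axis i 1)" and f''="\<lambda>t. f'' i (x + t *\<^sub>R axis i 1)", OF d(1)])
    have "isCont (f'' i) (x + 0 *\<^sub>R axis i 1)"
      using continuous_on_interior[OF cont] S by (simp add: interior_open)
    then show "isCont (\<lambda>t. f'' i (x + t *\<^sub>R axis i 1)) 0"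
      by (rule isCont_o2[where f="\<lambda>t. x + t *\<^sub>R axis i 1", rotated]) (intro continuous_intros)
    show "((\<lambda>t. f (x + t *\<^sub>R axis i 1)) has_real_derivative f' i (x + t *\<^sub>R axis i 1)) (at t)"
      if "\<bar>t\<bar> < d" for t
      by (rule f'[OF in_S[OF that]])
    show "((\<lambda>t. f' i (x + t *\<^sub>R axis i 1)) has_real_derivative f'' i (x + t *\<^sub>R axis i 1)) (at t)"
      if "\<bar>t\<bar> < d" for t
      by (rule f''[OF in_S[OF that]])
  qed
  then show ?thesis
    unfolding lap_quotient_def sum_divide_distrib by (intro tendsto_sum) simp
qed

subsection \<open>The Poisson kernel\<close>

definition poisson_kernel :: "real^('n::finite) \<Rightarrow> real^'n \<Rightarrow> real" where
  "poisson_kernel x \<omega> = (1 - (norm x)\<^sup>2) / norm (x - \<omega>) ^ CARD('n)"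

lemma poisson_kernel_nonneg: "norm x \<le> 1 \<Longrightarrow> 0 \<le> poisson_kernel x \<omega>"
  by (simp add: poisson_kernel_def power_le_one)

lemma poisson_kernel_0: "norm \<omega> = 1 \<Longrightarrow> poisson_kernel 0 \<omega> = 1"
  by (simp add: poisson_kernel_def)

text \<open>Along an axis the squared distance is a quadratic polynomial, whose real powers are easy
  to differentiate. At \<open>x = \<omega>\<close> the factor \<open>1 - x \<bullet> x\<close> makes
  both sides 0.\<close>

lemma poisson_kernel_eq_powr:
  fixes x \<omega> :: "real^('n::finite)"
  assumes "norm \<omega> = 1"
  shows "poisson_kernel x \<omega> = (1 - x \<bullet> x) * ((x - \<omega>) \<bullet> (x - \<omega>)) powr (- (real CARD('n) / 2))"
proof (cases "x = \<omega>")
  case True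
  then show ?thesis
    using assms by (simp add: poisson_kernel_def dot_square_norm)
next
  case False
  then have pos: "norm (x - \<omega>) > 0"
    by simp
  have "(x - \<omega>) \<bullet> (x - \<omega>) = norm (x - \<omega>) powr 2"
    using pos by (simp add: dot_square_norm powr_numeral)
  then have "((x - \<omega>) \<bullet> (x - \<omega>)) powr (- (real CARD('n) / 2)) = norm (x - \<omega>) powr (- real CARD('n))"
    by (simp only: powr_powr) simp
  also have "\<dots> = inverse (norm (x - \<omega>) ^ CARD('n))"
    by (simp only: powr_minus powr_realpow[OF pos])
  finally show ?thesis
    unfolding poisson_kernel_def power2_norm_eq_inner divide_inverse by simp
qed

text \<open>
  First and second derivative along the \<open>i\<close>-th axis of \<open>(1 - |x|\<^sup>2) q\<^sup>s\<close>, where \<open>q = |x - \<omega>|\<^sup>2\<close>.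
\<close>

definition poisson_d1 :: "real \<Rightarrow> real^('n::finite) \<Rightarrow> 'n \<Rightarrow> real^'n \<Rightarrow> real" where
  "poisson_d1 s \<omega> i x = - 2 * x $ i * ((x - \<omega>) \<bullet> (x - \<omega>)) powr s +
     (1 - x \<bullet> x) * (s * (((x - \<omega>) \<bullet> (x - \<omega>)) powr (s - 1) * (2 * (x - \<omega>) $ i)))"

definition poisson_d2 :: "real \<Rightarrow> real^('n::finite) \<Rightarrow> 'n \<Rightarrow> real^'n \<Rightarrow> real" where
  "poisson_d2 s \<omega> i x = - 2 * ((x - \<omega>) \<bullet> (x - \<omega>)) powr s -
     8 * s * (x $ i * (x - \<omega>) $ i) * ((x - \<omega>) \<bullet> (x - \<omega>)) powr (s - 1) +
     (1 - x \<bullet> x) * (4 * s * (s - 1) * ((x - \<omega>) $ i * (x - \<omega>) $ i) * ((x - \<omega>) \<bullet> (x - \<omega>)) powr (s - 1 - 1) +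
       2 * s * ((x - \<omega>) \<bullet> (x - \<omega>)) powr (s - 1))"

section \<open>Derivatives and harmonicity of the kernel\<close>

lemma has_real_derivative_inner_self_line:
  fixes y :: "real^('n::finite)"
  shows "((\<lambda>t. (y + t *\<^sub>R axis i 1) \<bullet> (y + t *\<^sub>R axis i 1)) has_real_derivative
    2 * (y + t *\<^sub>R axis i 1) $ i) (at t)"
proof -
  have "(y + t *\<^sub>R axis i 1) \<bullet> (y + t *\<^sub>R axis i 1) = y \<bullet> y + 2 * t * y $ i + t * t" for t
    by (simp add: inner_add_left inner_add_right inner_axis inner_axis' inner_axis_axis algebra_simps)
  moreover have "((\<lambda>t. y \<bullet> y + 2 * t * y $ i + t * t) has_real_derivative 2 * (y + t *\<^sub>R axis i 1) $ i) (at t)"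
    by (auto intro!: derivative_eq_intros simp: algebra_simps)
  ultimately show ?thesis
    by simp
qed

text \<open>Scalar model of the calculation along an axis: \<open>A\<close> stands for
  \<open>1 - x \<bullet> x\<close>, \<open>Q\<close> for the squared distance to
  \<open>\<omega>\<close>, \<open>X\<close> and \<open>Y\<close> for the moving coordinates of
  \<open>x\<close> and \<open>x - \<omega>\<close>.\<close>

lemma
  fixes A Q X Y :: "real \<Rightarrow> real"
  assumes A: "(A has_real_derivative - 2 * X t) (at t)" and Q: "(Q has_real_derivative 2 * Y t) (at t)"
    and X: "(X has_real_derivative 1) (at t)" and Y: "(Y has_real_derivative 1) (at t)" and pos: "0 < Q t"
  shows has_real_derivative_mult_powr: "((\<lambda>t. A t * Q t powr s) has_real_derivative
      - 2 * X t * Q t powr s + A t * (s * (Q t powr (s - 1) * (2 * Y t)))) (at t)"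
    and has_real_derivative_mult_powr2:
      "((\<lambda>t. - 2 * X t * Q t powr s + A t * (s * (Q t powr (s - 1) * (2 * Y t)))) has_real_derivative
      - 2 * Q t powr s - 8 * s * (X t * Y t) * Q t powr (s - 1) +
      A t * (4 * s * (s - 1) * (Y t * Y t) * Q t powr (s - 1 - 1) + 2 * s * Q t powr (s - 1))) (at t)"
proof -
  have P: "((\<lambda>t. Q t powr r) has_real_derivative r * Q t powr (r - 1) * (2 * Y t)) (at t)" for r
    by (rule DERIV_chain2[OF has_real_derivative_powr[OF pos] Q])
  show "((\<lambda>t. A t * Q t powr s) has_real_derivative
      - 2 * X t * Q t powr s + A t * (s * (Q t powr (s - 1) * (2 * Y t)))) (at t)"
    by (rule DERIV_cong[OF DERIV_mult[OF A P]]) (simp add: algebra_simps)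
  show "((\<lambda>t. - 2 * X t * Q t powr s + A t * (s * (Q t powr (s - 1) * (2 * Y t)))) has_real_derivative
      - 2 * Q t powr s - 8 * s * (X t * Y t) * Q t powr (s - 1) +
      A t * (4 * s * (s - 1) * (Y t * Y t) * Q t powr (s - 1 - 1) + 2 * s * Q t powr (s - 1))) (at t)"
    by (rule DERIV_cong[OF DERIV_add[OF DERIV_mult[OF DERIV_cmult[OF X] P]
          DERIV_mult[OF A DERIV_cmult[OF DERIV_mult[OF P DERIV_cmult[OF Y]]]]]])
      (simp add: algebra_simps)
qed

lemma
  fixes x \<omega> :: "real^('n::finite)"
  assumes "x + t *\<^sub>R axis i 1 \<noteq> \<omega>"
  shows has_real_derivative_poisson_d1:
    "((\<lambda>t. (1 - (x + t *\<^sub>R axis i 1) \<bullet> (x + t *\<^sub>R axis i 1)) *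
        ((x + t *\<^sub>R axis i 1 - \<omega>) \<bullet> (x + t *\<^sub>R axis i 1 - \<omega>)) powr s)
      has_real_derivative poisson_d1 s \<omega> i (x + t *\<^sub>R axis i 1)) (at t)" (is ?d1)
    and has_real_derivative_poisson_d2:
    "((\<lambda>t. poisson_d1 s \<omega> i (x + t *\<^sub>R axis i 1))
      has_real_derivative poisson_d2 s \<omega> i (x + t *\<^sub>R axis i 1)) (at t)" (is ?d2)
proof -
  have shift: "x + t *\<^sub>R axis i 1 - \<omega> = (x - \<omega>) + t *\<^sub>R axis i 1" for t
    by simp
  have "((\<lambda>t. 1 - (x + t *\<^sub>R axis i 1) \<bullet> (x + t *\<^sub>R axis i 1)) has_real_derivative
      0 - 2 * (x + t *\<^sub>R axis i 1) $ i) (at t)"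
    by (intro DERIV_diff DERIV_const has_real_derivative_inner_self_line)
  then have A: "((\<lambda>t. 1 - (x + t *\<^sub>R axis i 1) \<bullet> (x + t *\<^sub>R axis i 1)) has_real_derivative
      - 2 * (x + t *\<^sub>R axis i 1) $ i) (at t)"
    by simp
  have comp: "((\<lambda>t. (y + t *\<^sub>R axis i 1) $ i) has_real_derivative 1) (at t)" for y :: "real^'n"
    by (auto intro!: derivative_eq_intros)
  have Q: "((\<lambda>t. (x + t *\<^sub>R axis i 1 - \<omega>) \<bullet> (x + t *\<^sub>R axis i 1 - \<omega>)) has_real_derivative
      2 * (x + t *\<^sub>R axis i 1 - \<omega>) $ i) (at t)"
    unfolding shift by (rule has_real_derivative_inner_self_line)
  have Y: "((\<lambda>t. (x + t *\<^sub>R axis i 1 - \<omega>) $ i) has_real_derivative 1) (at t)"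
    unfolding shift by (rule comp)
  have pos: "0 < (x + t *\<^sub>R axis i 1 - \<omega>) \<bullet> (x + t *\<^sub>R axis i 1 - \<omega>)"
    using assms by (simp only: inner_gt_zero_iff right_minus_eq) simp
  show ?d1
    unfolding poisson_d1_def by (rule has_real_derivative_mult_powr[OF A Q comp Y pos])
  show ?d2
    unfolding poisson_d1_def poisson_d2_def by (rule has_real_derivative_mult_powr2[OF A Q comp Y pos])
qed

text \<open>Harmonicity of the Poisson kernel: after summation, the exponent ties the dimension to
  \<open>- 2 * s\<close> and the powers of \<open>q\<close> reduce to \<open>p\<close>, leaving a
  polynomial identity.\<close>

lemma sum_poisson_d2:
  fixes x \<omega> :: "real^('n::finite)"
  assumes \<omega>: "norm \<omega> = 1" and x: "x \<noteq> \<omega>"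
  shows "(\<Sum>i\<in>UNIV. poisson_d2 (- (real CARD('n) / 2)) \<omega> i x) = 0"
proof -
  define s where "s = - (real CARD('n) / 2)"
  define q where "q = (x - \<omega>) \<bullet> (x - \<omega>)"
  define p where "p = q powr (s - 1)"
  have q: "q > 0"
    using x by (simp add: q_def)
  have p1: "q powr s = q * p" and p2: "q * q powr (s - 1 - 1) = p"
    using q powr_mult_base[of q "s - 1"] powr_mult_base[of q "s - 1 - 1"] by (simp_all add: p_def)
  have q_eq: "q = x \<bullet> x - 2 * (x \<bullet> \<omega>) + 1"
    using \<omega> unfolding q_def inner_diff_left inner_diff_right by (simp add: inner_commute dot_square_norm)
  have sum_x: "(\<Sum>i\<in>UNIV. x $ i * (x - \<omega>) $ i) = x \<bullet> x - x \<bullet> \<omega>"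
    by (simp add: inner_vec_def sum_subtractf right_diff_distrib)
  have sum_y: "(\<Sum>i\<in>UNIV. (x - \<omega>) $ i * (x - \<omega>) $ i) = q"
    by (simp add: q_def inner_vec_def)
  define r where "r = q powr (s - 1 - 1)"
  have d2: "poisson_d2 s \<omega> i x = - 2 * (q * p) - 8 * s * p * (x $ i * (x - \<omega>) $ i) +
      (1 - x \<bullet> x) * 4 * s * (s - 1) * r * ((x - \<omega>) $ i * (x - \<omega>) $ i) + (1 - x \<bullet> x) * (2 * s * p)" for i
    unfolding poisson_d2_def q_def[symmetric] p_def[symmetric] r_def[symmetric] p1 by algebra
  have "(\<Sum>i\<in>UNIV. poisson_d2 s \<omega> i x) = real CARD('n) * (- 2 * (q * p)) - 8 * s * p * (x \<bullet> x - x \<bullet> \<omega>) +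
      (1 - x \<bullet> x) * 4 * s * (s - 1) * r * q + real CARD('n) * ((1 - x \<bullet> x) * (2 * s * p))"
    by (simp only: d2 sum.distrib sum_subtractf sum_distrib_left[symmetric] sum_x sum_y sum_constant) algebra
  also have "\<dots> = - 2 * s * (- 2 * (q * p)) - 8 * s * p * (x \<bullet> x - x \<bullet> \<omega>) +
      (1 - x \<bullet> x) * 4 * s * (s - 1) * p + - 2 * s * ((1 - x \<bullet> x) * (2 * s * p))"
    unfolding p2[folded r_def, symmetric] by (simp add: s_def mult.commute mult.left_commute)
  \<comment> \<open>The expression is \<open>4 * s * p\<close> times
    \<open>q - x \<bullet> x + 2 * (x \<bullet> \<omega>) - 1\<close>, which vanishes by the
    expansion of \<open>q\<close> for a unit vector \<open>\<omega>\<close>.\<close>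
  also have "\<dots> = 0"
    unfolding q_eq by algebra
  finally show ?thesis
    by (simp add: s_def)
qed

section \<open>Bounds for the kernel and weak harmonicity of Poisson integrals\<close>

lemma norm_diff_ge_sphere:
  fixes x \<omega> :: "'a::real_normed_vector"
  assumes "norm \<omega> = 1"
  shows "1 - norm x \<le> norm (x - \<omega>)"
  using norm_triangle_ineq2[of \<omega> x] assms by (simp add: norm_minus_commute)

text \<open>Continuity is joint in both variables, so that compactness bounds the second derivatives
  uniformly in the boundary point.\<close>

lemma continuous_on_poisson_d2:
  fixes S :: "((real^('n::finite)) \<times> (real^'n)) set"
  assumes "\<And>x \<omega>. (x, \<omega>) \<in> S \<Longrightarrow> x \<noteq> \<omega>"
  shows "continuous_on S (\<lambda>(x, \<omega>). poisson_d2 s \<omega> i x)"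
  unfolding poisson_d2_def case_prod_unfold
  using assms by (intro continuous_intros) auto

lemma poisson_kernel_bounded:
  fixes x \<omega> :: "real^('n::finite)"
  assumes "norm x \<le> \<rho>" "\<rho> < 1" "norm \<omega> = 1"
  shows "poisson_kernel x \<omega> \<le> 1 / (1 - \<rho>) ^ CARD('n)"
proof -
  have "(1 - \<rho>) ^ CARD('n) \<le> norm (x - \<omega>) ^ CARD('n)"
    using norm_diff_ge_sphere[OF assms(3), of x] assms by (intro power_mono) auto
  then show ?thesis
    using assms unfolding poisson_kernel_def by (intro frac_le) auto
qed

lemma continuous_on_poisson_kernel:
  fixes x :: "real^('n::finite)"
  assumes "norm x < 1"
  shows "continuous_on (sphere 0 1) (poisson_kernel x)"
  unfolding poisson_kernel_def using assms by (intro continuous_intros) auto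

lemma poisson_integral_eq: "poisson_integral g x = (LINT \<omega>|sphere_measure. poisson_kernel x \<omega> *\<^sub>R g \<omega>)"
  by (simp add: poisson_integral_def poisson_kernel_def)

lemma integrable_poisson_kernel:
  fixes x :: "real^('n::finite)" and g :: "real^'n \<Rightarrow> 'b::{banach,second_countable_topology}"
  assumes "norm x < 1" "continuous_on (sphere 0 1) g"
  shows "integrable sphere_measure (\<lambda>\<omega>. poisson_kernel x \<omega> *\<^sub>R g \<omega>)"
  by (intro continuous_on_sphere_integrable continuous_intros continuous_on_poisson_kernel assms)

lemma poisson_kernel_line_derivatives:
  fixes x \<omega> :: "real^('n::finite)"
  assumes \<omega>: "norm \<omega> = 1" and x: "x + t *\<^sub>R axis i 1 \<in> ball 0 1"
  shows "((\<lambda>t. poisson_kernel (x + t *\<^sub>R axis i 1) \<omega>) has_real_derivative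
      poisson_d1 (- (real CARD('n) / 2)) \<omega> i (x + t *\<^sub>R axis i 1)) (at t)"
    and "((\<lambda>t. poisson_d1 (- (real CARD('n) / 2)) \<omega> i (x + t *\<^sub>R axis i 1)) has_real_derivative
      poisson_d2 (- (real CARD('n) / 2)) \<omega> i (x + t *\<^sub>R axis i 1)) (at t)"
proof -
  have "x + t *\<^sub>R axis i 1 \<noteq> \<omega>"
    using \<omega> x by auto
  then show "((\<lambda>t. poisson_kernel (x + t *\<^sub>R axis i 1) \<omega>) has_real_derivative
      poisson_d1 (- (real CARD('n) / 2)) \<omega> i (x + t *\<^sub>R axis i 1)) (at t)"
    "((\<lambda>t. poisson_d1 (- (real CARD('n) / 2)) \<omega> i (x + t *\<^sub>R axis i 1)) has_real_derivative
      poisson_d2 (- (real CARD('n) / 2)) \<omega> i (x + t *\<^sub>R axis i 1)) (at t)"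
    unfolding poisson_kernel_eq_powr[OF \<omega>]
    by (fact has_real_derivative_poisson_d1 has_real_derivative_poisson_d2)+
qed

lemma lap_quotient_poisson_kernel_tendsto:
  fixes x \<omega> :: "real^('n::finite)"
  assumes \<omega>: "norm \<omega> = 1" and x: "norm x < 1"
  shows "(\<lambda>k. lap_quotient (\<lambda>x. poisson_kernel x \<omega>) x (inverse (real (Suc k)))) \<longlonglongrightarrow> 0"
proof -
  have "(\<lambda>k. lap_quotient (\<lambda>x. poisson_kernel x \<omega>) x (inverse (real (Suc k)))) \<longlonglongrightarrow>
      (\<Sum>i\<in>UNIV. poisson_d2 (- (real CARD('n) / 2)) \<omega> i x)"
  proof (rule lap_quotient_tendsto_sum[where S="ball 0 1" and f'="poisson_d1 (- (real CARD('n) / 2)) \<omega>"])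
    show "continuous_on (ball 0 1) (poisson_d2 (- (real CARD('n) / 2)) \<omega> i)" for i
      unfolding poisson_d2_def using \<omega> by (intro continuous_intros) auto
    show "((\<lambda>t. poisson_kernel (x + t *\<^sub>R axis i 1) \<omega>) has_real_derivative
        poisson_d1 (- (real CARD('n) / 2)) \<omega> i (x + t *\<^sub>R axis i 1)) (at t)"
      "((\<lambda>t. poisson_d1 (- (real CARD('n) / 2)) \<omega> i (x + t *\<^sub>R axis i 1)) has_real_derivative
        poisson_d2 (- (real CARD('n) / 2)) \<omega> i (x + t *\<^sub>R axis i 1)) (at t)"
      if "x + t *\<^sub>R axis i 1 \<in> ball 0 1" for i t
      by (fact poisson_kernel_line_derivatives[OF \<omega> that])+
  qed (use x in auto)
  moreover have "x \<noteq> \<omega>"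
    using \<omega> x by auto
  ultimately show ?thesis
    using sum_poisson_d2[OF \<omega>] by simp
qed

text \<open>The dominating constant for second differences under the integral. The mean value form
  reduces it to a bound on the second derivatives over the compact set
  \<open>cball 0 \<rho> \<times> sphere 0 1\<close>, which avoids the singularity.\<close>

lemma lap_quotient_poisson_kernel_bounded:
  fixes \<rho> :: real
  assumes \<rho>: "\<rho> < 1"
  obtains C where "\<And>x \<omega> t. norm \<omega> = 1 \<Longrightarrow> 0 < t \<Longrightarrow> norm (x::real^('n::finite)) + t \<le> \<rho> \<Longrightarrow>
    \<bar>lap_quotient (\<lambda>x. poisson_kernel x \<omega>) x t\<bar> \<le> C"
proof -
  let ?s = "- (real CARD('n) / 2)"
  have "\<exists>B. \<forall>p\<in>cball (0::real^'n) \<rho> \<times> sphere 0 1. norm ((\<lambda>(x, \<omega>). poisson_d2 ?s \<omega> i x) p) \<le> B" for i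
  proof -
    have "bounded ((\<lambda>(x, \<omega>). poisson_d2 ?s \<omega> i x) ` (cball (0::real^'n) \<rho> \<times> sphere 0 1))"
      using \<rho> by (intro compact_imp_bounded compact_continuous_image continuous_on_poisson_d2 compact_Times) auto
    then show ?thesis
      unfolding bounded_iff by blast
  qed
  then obtain B where B: "\<And>i x \<omega>. norm (x::real^'n) \<le> \<rho> \<Longrightarrow> norm \<omega> = 1 \<Longrightarrow> \<bar>poisson_d2 ?s \<omega> i x\<bar> \<le> B i"
    by (simp only: Ball_def) (metis (mono_tags, lifting) SigmaI case_prod_conv dist_0_norm mem_cball mem_sphere real_norm_def)
  show ?thesis
  proof (rule that[of "\<Sum>i\<in>UNIV. B i"])
    fix x \<omega> :: "real^'n" and t :: real
    assume \<omega>: "norm \<omega> = 1" and t: "0 < t" and x: "norm x + t \<le> \<rho>"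
    have line: "norm (x + s *\<^sub>R axis i 1) \<le> \<rho>" if "\<bar>s\<bar> \<le> t" for s and i :: 'n
      using norm_triangle_ineq[of x "s *\<^sub>R axis i 1"] x that by simp
    have "\<bar>poisson_kernel (x + t *\<^sub>R axis i 1) \<omega> + poisson_kernel (x - t *\<^sub>R axis i 1) \<omega> - 2 * poisson_kernel x \<omega>\<bar> \<le>
        t\<^sup>2 * B i" for i
    proof -
      obtain s where s: "\<bar>s\<bar> \<le> t" "poisson_kernel (x + t *\<^sub>R axis i 1) \<omega> + poisson_kernel (x + (- t) *\<^sub>R axis i 1) \<omega>
          - 2 * poisson_kernel (x + 0 *\<^sub>R axis i 1) \<omega> =
          t\<^sup>2 * ((poisson_d2 ?s \<omega> i (x + s *\<^sub>R axis i 1) + poisson_d2 ?s \<omega> i (x + (- s) *\<^sub>R axis i 1)) / 2)"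
      proof (rule second_difference_mean_value[where f="\<lambda>t. poisson_kernel (x + t *\<^sub>R axis i 1) \<omega>"
            and f'="\<lambda>t. poisson_d1 ?s \<omega> i (x + t *\<^sub>R axis i 1)"
            and f''="\<lambda>t. poisson_d2 ?s \<omega> i (x + t *\<^sub>R axis i 1)", OF t])
        fix s :: real
        assume "\<bar>s\<bar> \<le> t"
        then have "x + s *\<^sub>R axis i 1 \<in> ball 0 1"
          using line[of s i] \<rho> by simp
        then show "((\<lambda>t. poisson_kernel (x + t *\<^sub>R axis i 1) \<omega>) has_real_derivative
            poisson_d1 ?s \<omega> i (x + s *\<^sub>R axis i 1)) (at s)"
          "((\<lambda>t. poisson_d1 ?s \<omega> i (x + t *\<^sub>R axis i 1)) has_real_derivative
            poisson_d2 ?s \<omega> i (x + s *\<^sub>R axis i 1)) (at s)"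
          by (fact poisson_kernel_line_derivatives[OF \<omega>])+
      qed
      define d where "d = (poisson_d2 ?s \<omega> i (x + s *\<^sub>R axis i 1) + poisson_d2 ?s \<omega> i (x + (- s) *\<^sub>R axis i 1)) / 2"
      have eq: "poisson_kernel (x + t *\<^sub>R axis i 1) \<omega> + poisson_kernel (x - t *\<^sub>R axis i 1) \<omega> - 2 * poisson_kernel x \<omega> =
          t\<^sup>2 * d"
        using s(2)[folded d_def] by simp
      have "\<bar>poisson_d2 ?s \<omega> i (x + s *\<^sub>R axis i 1)\<bar> \<le> B i" "\<bar>poisson_d2 ?s \<omega> i (x + (- s) *\<^sub>R axis i 1)\<bar> \<le> B i"
        using s(1) by (auto intro!: B[OF line \<omega>] simp del: scaleR_minus_left)
      then have "\<bar>d\<bar> \<le> B i"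
        unfolding d_def by (simp add: abs_le_iff field_simps)
      then show ?thesis
        unfolding eq by (simp add: abs_mult mult_left_mono)
    qed
    then have "\<bar>\<Sum>i\<in>UNIV. poisson_kernel (x + t *\<^sub>R axis i 1) \<omega> + poisson_kernel (x - t *\<^sub>R axis i 1) \<omega> -
        2 * poisson_kernel x \<omega>\<bar> \<le> (\<Sum>i\<in>UNIV. t\<^sup>2 * B i)"
      by (intro order_trans[OF sum_abs] sum_mono)
    then show "\<bar>lap_quotient (\<lambda>x. poisson_kernel x \<omega>) x t\<bar> \<le> (\<Sum>i\<in>UNIV. B i)"
      using t by (simp add: lap_quotient_def abs_divide pos_divide_le_eq sum_distrib_right mult.commute)
  qed
qed

lemma lap_quotient_poisson_integral:
  fixes x :: "real^('n::finite)" and g :: "real^'n \<Rightarrow> real"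
  assumes x: "norm x + \<bar>t\<bar> < 1" and g: "continuous_on (sphere 0 1) g"
  shows "lap_quotient (poisson_integral g) x t =
    (LINT \<omega>|sphere_measure. lap_quotient (\<lambda>x. poisson_kernel x \<omega>) x t * g \<omega>)"
proof -
  have nx: "norm x < 1"
    using x by linarith
  have near: "norm (x + t *\<^sub>R axis i 1) < 1" "norm (x - t *\<^sub>R axis i 1) < 1" for i :: 'n
    using norm_triangle_ineq[of x "t *\<^sub>R axis i 1"] norm_triangle_ineq4[of x "t *\<^sub>R axis i 1"] x by simp_all
  have int: "integrable sphere_measure (\<lambda>\<omega>. poisson_kernel y \<omega> * g \<omega>)" if "norm y < 1" for y
    using integrable_poisson_kernel[OF that g] by simp
  note ints = int[OF near(1)] int[OF near(2)] int[OF nx]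
  have "(LINT \<omega>|sphere_measure. lap_quotient (\<lambda>x. poisson_kernel x \<omega>) x t * g \<omega>) =
      (LINT \<omega>|sphere_measure. (\<Sum>i\<in>UNIV. poisson_kernel (x + t *\<^sub>R axis i 1) \<omega> * g \<omega> +
        poisson_kernel (x - t *\<^sub>R axis i 1) \<omega> * g \<omega> - 2 * (poisson_kernel x \<omega> * g \<omega>)) / t\<^sup>2)"
    by (intro Bochner_Integration.integral_cong refl)
      (simp add: lap_quotient_def sum_distrib_right left_diff_distrib distrib_right mult.assoc)
  also have "\<dots> = (\<Sum>i\<in>UNIV. (LINT \<omega>|sphere_measure. poisson_kernel (x + t *\<^sub>R axis i 1) \<omega> * g \<omega>) +
        (LINT \<omega>|sphere_measure. poisson_kernel (x - t *\<^sub>R axis i 1) \<omega> * g \<omega>) -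
        2 * (LINT \<omega>|sphere_measure. poisson_kernel x \<omega> * g \<omega>)) / t\<^sup>2"
    unfolding integral_divide_zero
    by (subst Bochner_Integration.integral_sum)
      (use ints in \<open>simp_all del: right_diff_distrib_numeral\<close>)
  also have "\<dots> = lap_quotient (poisson_integral g) x t"
    by (simp add: lap_quotient_def poisson_integral_eq)
  finally show ?thesis ..
qed

lemma weakly_harmonic_at_poisson_integral:
  fixes x :: "real^('n::finite)" and g :: "real^'n \<Rightarrow> real"
  assumes x: "norm x < 1" and g: "continuous_on (sphere 0 1) g"
  shows "weakly_harmonic_at (poisson_integral g) x"
proof -
  define \<rho> where "\<rho> = (1 + norm x) / 2"
  have \<rho>: "norm x < \<rho>" "\<rho> < 1"
    using x by (simp_all add: \<rho>_def)
  obtain C where C: "\<And>y \<omega> t. norm \<omega> = 1 \<Longrightarrow> 0 < t \<Longrightarrow> norm (y::real^'n) + t \<le> \<rho> \<Longrightarrow>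
      \<bar>lap_quotient (\<lambda>x. poisson_kernel x \<omega>) y t\<bar> \<le> C"
    using lap_quotient_poisson_kernel_bounded[OF \<rho>(2)] by blast
  have "eventually (\<lambda>k. inverse (real (Suc k)) < \<rho> - norm x) sequentially"
    using LIMSEQ_inverse_real_of_nat \<rho>(1) by (intro order_tendstoD) auto
  then obtain N where N: "\<And>k. N \<le> k \<Longrightarrow> inverse (real (Suc k)) < \<rho> - norm x"
    by (auto simp: eventually_sequentially)
  \<comment> \<open>Dropping the first \<open>N\<close> steps keeps all shifted points in the ball
    of radius \<open>\<rho>\<close>, where \<open>C\<close> is valid.\<close>
  define t where "t k = inverse (real (Suc (k + N)))" for k
  have t: "0 < t k" "norm x + t k \<le> \<rho>" for k
    using N[of "k + N"] by (simp_all add: t_def del: of_nat_Suc)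
  have "(\<lambda>k. LINT \<omega>|sphere_measure. lap_quotient (\<lambda>x. poisson_kernel x \<omega>) x (t k) * g \<omega>) \<longlonglongrightarrow>
      (LINT \<omega>|(sphere_measure :: (real^'n) measure). 0)"
  proof (rule integral_dominated_convergence[where w="\<lambda>\<omega>. C * \<bar>g \<omega>\<bar>"])
    show "integrable sphere_measure (\<lambda>\<omega>. C * \<bar>g \<omega>\<bar>)"
      by (intro continuous_on_sphere_integrable continuous_intros g)
    show "(\<lambda>\<omega>. lap_quotient (\<lambda>x. poisson_kernel x \<omega>) x (t k) * g \<omega>) \<in> borel_measurable sphere_measure" for k
    proof (intro continuous_on_sphere_measurable continuous_on_mult g)
      have "norm (x + t k *\<^sub>R axis i 1) < 1" "norm (x - t k *\<^sub>R axis i 1) < 1" for i :: 'n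
        using norm_triangle_ineq[of x "t k *\<^sub>R axis i 1"] norm_triangle_ineq4[of x "t k *\<^sub>R axis i 1"] t[of k] \<rho>
        by simp_all
      then show "continuous_on (sphere 0 1) (\<lambda>\<omega>. lap_quotient (\<lambda>x. poisson_kernel x \<omega>) x (t k))"
        unfolding lap_quotient_def using t(1)[of k]
        by (intro continuous_intros continuous_on_poisson_kernel x) auto
    qed
    show "AE \<omega> in sphere_measure. (\<lambda>k. lap_quotient (\<lambda>x. poisson_kernel x \<omega>) x (t k) * g \<omega>) \<longlonglongrightarrow> 0"
    proof (rule AE_I2)
      fix \<omega> :: "real^'n"
      assume "\<omega> \<in> space sphere_measure"
      then have "(\<lambda>k. lap_quotient (\<lambda>x. poisson_kernel x \<omega>) x (t k)) \<longlonglongrightarrow> 0"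
        unfolding t_def using lap_quotient_poisson_kernel_tendsto[OF _ x, of \<omega>]
        by (intro LIMSEQ_ignore_initial_segment) simp
      then show "(\<lambda>k. lap_quotient (\<lambda>x. poisson_kernel x \<omega>) x (t k) * g \<omega>) \<longlonglongrightarrow> 0"
        by (rule tendsto_mult_left_zero)
    qed
    show "AE \<omega> in sphere_measure. norm (lap_quotient (\<lambda>x. poisson_kernel x \<omega>) x (t k) * g \<omega>) \<le> C * \<bar>g \<omega>\<bar>" for k
      using C t by (intro AE_I2) (auto simp: abs_mult intro!: mult_right_mono)
  qed simp
  moreover have "lap_quotient (poisson_integral g) x (t k) =
      (LINT \<omega>|sphere_measure. lap_quotient (\<lambda>x. poisson_kernel x \<omega>) x (t k) * g \<omega>)" for k
    using t[of k] \<rho> g by (intro lap_quotient_poisson_integral) auto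
  ultimately have "(\<lambda>k. lap_quotient (poisson_integral g) x (t k)) \<longlonglongrightarrow> 0"
    by simp
  then show ?thesis
    unfolding weakly_harmonic_at_def t_def by (rule LIMSEQ_offset)
qed

subsection \<open>The Poisson formula\<close>

lemma poisson_kernel_orthogonal:
  fixes T :: "real^('n::finite) \<Rightarrow> real^'n"
  assumes "orthogonal_transformation T"
  shows "poisson_kernel (T x) (T \<omega>) = poisson_kernel x \<omega>"
  using assms by (simp add: poisson_kernel_def orthogonal_transformation_norm orthogonal_transformation_linear
      flip: linear_diff)

text \<open>On a ball of radius \<open>\<rho> < 1\<close> the kernel is bounded uniformly, and
  dominated convergence applies.\<close>

lemma continuous_on_poisson_integral:
  fixes g :: "real^('n::finite) \<Rightarrow> real"
  assumes \<rho>: "\<rho> < 1" and g: "continuous_on (sphere 0 1) g"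
  shows "continuous_on (cball 0 \<rho>) (poisson_integral g)"
proof (rule continuous_on_sequentiallyI)
  fix y :: "nat \<Rightarrow> real^'n" and x
  assume y: "\<forall>n. y n \<in> cball 0 \<rho>" and x: "x \<in> cball 0 \<rho>" and lim: "y \<longlonglongrightarrow> x"
  have ny: "norm (y n) < 1" "norm (y n) \<le> \<rho>" for n
    using y[rule_format, of n] \<rho> by simp_all
  have nx: "norm x < 1"
    using x \<rho> by simp
  let ?C = "1 / (1 - \<rho>) ^ CARD('n)"
  show "(\<lambda>n. poisson_integral g (y n)) \<longlonglongrightarrow> poisson_integral g x"
    unfolding poisson_integral_eq
  proof (rule integral_dominated_convergence[where w="\<lambda>\<omega>. ?C * \<bar>g \<omega>\<bar>"])
    show "integrable sphere_measure (\<lambda>\<omega>. ?C * \<bar>g \<omega>\<bar>)"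
      by (intro continuous_on_sphere_integrable continuous_intros g)
    show "(\<lambda>\<omega>. poisson_kernel x \<omega> *\<^sub>R g \<omega>) \<in> borel_measurable sphere_measure"
      using integrable_poisson_kernel[OF nx g] by (rule borel_measurable_integrable)
    show "(\<lambda>\<omega>. poisson_kernel (y n) \<omega> *\<^sub>R g \<omega>) \<in> borel_measurable sphere_measure" for n
      using integrable_poisson_kernel[OF ny(1) g] by (rule borel_measurable_integrable)
    show "AE \<omega> in sphere_measure. (\<lambda>n. poisson_kernel (y n) \<omega> *\<^sub>R g \<omega>) \<longlonglongrightarrow> poisson_kernel x \<omega> *\<^sub>R g \<omega>"
    proof (rule AE_I2)
      fix \<omega> :: "real^'n"
      assume "\<omega> \<in> space sphere_measure"
      then have "norm (x - \<omega>) ^ CARD('n) \<noteq> 0"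
        using nx by auto
      then show "(\<lambda>n. poisson_kernel (y n) \<omega> *\<^sub>R g \<omega>) \<longlonglongrightarrow> poisson_kernel x \<omega> *\<^sub>R g \<omega>"
        unfolding poisson_kernel_def by (intro tendsto_intros lim)
    qed
    show "AE \<omega> in sphere_measure. norm (poisson_kernel (y n) \<omega> *\<^sub>R g \<omega>) \<le> ?C * \<bar>g \<omega>\<bar>" for n
    proof (rule AE_I2)
      fix \<omega> :: "real^'n"
      assume "\<omega> \<in> space sphere_measure"
      then have "poisson_kernel (y n) \<omega> \<le> ?C" "0 \<le> poisson_kernel (y n) \<omega>"
        using ny[of n] \<rho> by (auto intro!: poisson_kernel_bounded poisson_kernel_nonneg)
      then show "norm (poisson_kernel (y n) \<omega> *\<^sub>R g \<omega>) \<le> ?C * \<bar>g \<omega>\<bar>"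
        by (simp only: real_scaleR_def real_norm_def abs_mult abs_of_nonneg) (rule mult_right_mono, simp_all)
    qed
  qed
qed

text \<open>The integral of the kernel is a radial harmonic function, hence constant by the maximum principle.\<close>

lemma integral_poisson_kernel:
  fixes x :: "real^('n::finite)"
  assumes x: "norm x < 1"
  shows "(LINT \<omega>|sphere_measure. poisson_kernel x \<omega>) = 1"
proof -
  define f where "f = poisson_integral (\<lambda>_::real^'n. 1::real)"
  have f_eq: "f y = (LINT \<omega>|sphere_measure. poisson_kernel y \<omega>)" for y
    by (simp add: f_def poisson_integral_eq)
  have radial: "f y = f x" if y: "norm y = norm x" for y
  proof -
    obtain T where T: "orthogonal_transformation T" "T x = y"
      using orthogonal_transformation_exists y by metis
    have "f y = (LINT \<omega>|sphere_measure. poisson_kernel (T x) (T \<omega>))"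
      unfolding f_eq T(2) using x y
      by (intro integral_sphere_measure_orthogonal[OF T(1), symmetric] continuous_on_sphere_measurable
          continuous_on_poisson_kernel) simp
    then show ?thesis
      by (simp add: poisson_kernel_orthogonal[OF T(1)] f_eq)
  qed
  have cont: "continuous_on (cball 0 (norm x)) f"
    unfolding f_def by (intro continuous_on_poisson_integral x continuous_on_const)
  have harm: "weakly_harmonic_at f y" if "y \<in> ball 0 (norm x)" for y
    unfolding f_def using that x by (intro weakly_harmonic_at_poisson_integral) auto
  have "f 0 \<le> f x"
  proof (rule weak_maximum_principle[OF cont])
    show "weakly_harmonic_at f y" if "y \<in> ball 0 (norm x)" for y
      using that by (rule harm)
    show "f y \<le> f x" if "norm y = norm x" for y
      unfolding radial[OF that] ..
  qed simp
  \<comment> \<open>The reverse inequality comes from the negative, written as a multiple to match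
    \<open>weakly_harmonic_at_cmult\<close>.\<close>
  moreover have "-1 * f 0 \<le> -1 * f x"
  proof (rule weak_maximum_principle[where R="norm x" and f="\<lambda>y. -1 * f y"])
    show "continuous_on (cball 0 (norm x)) (\<lambda>y. -1 * f y)"
      by (intro continuous_on_mult continuous_on_const cont)
    show "weakly_harmonic_at (\<lambda>y. -1 * f y) y" if "y \<in> ball 0 (norm x)" for y
      using that by (intro weakly_harmonic_at_cmult harm)
    show "-1 * f y \<le> -1 * f x" if "norm y = norm x" for y
      unfolding radial[OF that] ..
  qed simp
  moreover have "f 0 = 1"
  proof -
    have "f 0 = (LINT \<omega>|(sphere_measure :: (real^'n) measure). 1)"
      unfolding f_eq by (intro Bochner_Integration.integral_cong) (simp_all add: poisson_kernel_0)
    then show ?thesis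
      using emeasure_sphere_measure_space[where 'n='n] by (simp add: measure_def)
  qed
  ultimately show ?thesis
    by (simp add: f_eq)
qed

section \<open>Boundary behaviour and the representation formula\<close>

text \<open>The kernel is an approximate identity: it is nonnegative with mass 1, near
  \<open>x\<close> uniform continuity makes \<open>g\<close> almost constant, and at distance
  \<open>\<delta>\<close> or more the kernel is small because of its numerator. As \<open>g\<close>
  lives on the closed ball, the comparison is with \<open>g x\<close> itself, uniformly in the
  direction of \<open>x\<close>.\<close>

lemma poisson_integral_boundary:
  fixes g :: "real^('n::finite) \<Rightarrow> real"
  assumes g: "continuous_on (cball 0 1) g" and e: "0 < e"
  obtains s where "s < 1" "\<And>x. s \<le> norm x \<Longrightarrow> norm x < 1 \<Longrightarrow> \<bar>poisson_integral g x - g x\<bar> \<le> e"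
proof -
  have gs: "continuous_on (sphere 0 1) g"
    using g by (rule continuous_on_subset) auto
  have "bounded (g ` cball 0 1)"
    using g by (intro compact_imp_bounded compact_continuous_image) auto
  then obtain M where "\<forall>x\<in>cball 0 1. norm (g x) \<le> M"
    unfolding bounded_iff by blast
  then have M: "\<bar>g x\<bar> \<le> M" if "norm x \<le> 1" for x
    using that by simp
  have M0: "0 \<le> M"
    using M[of 0] by (simp add: order_trans[OF abs_ge_zero])
  have "uniformly_continuous_on (cball 0 1) g"
    using g by (intro compact_uniformly_continuous) auto
  then obtain \<delta> where \<delta>: "\<delta> > 0"
      "\<And>x y. x \<in> cball 0 1 \<Longrightarrow> y \<in> cball 0 1 \<Longrightarrow> dist y x < \<delta> \<Longrightarrow> dist (g y) (g x) < e / 2"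
    using e unfolding uniformly_continuous_on_def by (metis half_gt_zero)
  \<comment> \<open>Chosen so that \<open>1 - (norm x)\<^sup>2 \<le> 2 * \<eta>\<close> limits the
    far part \<open>c\<close> to \<open>e / 2\<close>; \<open>M + 1\<close> replaces
    \<open>M\<close> as a divisor since \<open>M\<close> may be 0.\<close>
  define \<eta> where "\<eta> = e / (4 * (M + 1)) * \<delta> ^ CARD('n) / 2"
  have \<eta>: "\<eta> > 0"
    using e \<delta>(1) M0 by (simp add: \<eta>_def)
  show ?thesis
  proof (rule that[of "1 - \<eta>"])
    fix x :: "real^'n"
    assume x: "1 - \<eta> \<le> norm x" "norm x < 1"
    define c where "c = (1 - (norm x)\<^sup>2) / \<delta> ^ CARD('n) * (2 * M)"
    have num: "0 \<le> 1 - (norm x)\<^sup>2"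
      using x by (simp add: power_le_one)
    have "1 - (norm x)\<^sup>2 \<le> 2 * \<eta>"
    proof -
      have "1 - (norm x)\<^sup>2 = (1 - norm x) * (1 + norm x)"
        by (simp add: power2_eq_square algebra_simps)
      also have "\<dots> \<le> \<eta> * 2"
        using x \<eta> by (intro mult_mono) auto
      finally show ?thesis
        by simp
    qed
    then have "c \<le> 2 * \<eta> / \<delta> ^ CARD('n) * (2 * M)"
      unfolding c_def using \<delta>(1) M0 by (intro mult_right_mono divide_right_mono) auto
    also have "\<dots> = e / 2 * (M / (M + 1))"
    proof -
      have "2 * \<eta> / \<delta> ^ CARD('n) = e / (4 * (M + 1))"
        using \<delta>(1) M0 by (simp add: \<eta>_def divide_simps)
      moreover have "e / (4 * (M + 1)) * (2 * M) = e / 2 * (M / (M + 1))"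
        using M0 by (simp add: divide_simps)
      ultimately show ?thesis
        by (simp only:)
    qed
    also have "\<dots> \<le> e / 2 * 1"
      using e M0 by (intro mult_left_mono) auto
    finally have c: "c \<le> e / 2"
      by simp
    have pk: "integrable sphere_measure (poisson_kernel x)"
      using x by (intro continuous_on_sphere_integrable continuous_on_poisson_kernel)
    have pkg: "integrable sphere_measure (\<lambda>\<omega>. poisson_kernel x \<omega> * g \<omega>)"
      using integrable_poisson_kernel[OF x(2) gs] by simp
    have diff_int: "integrable sphere_measure (\<lambda>\<omega>. poisson_kernel x \<omega> * (g \<omega> - g x))"
      using pk pkg by (simp add: right_diff_distrib)
    have "poisson_integral g x - g x = (LINT \<omega>|sphere_measure. poisson_kernel x \<omega> * g \<omega>) -
        (LINT \<omega>|sphere_measure. poisson_kernel x \<omega> * g x)"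
      using integral_poisson_kernel[OF x(2)] by (simp add: poisson_integral_eq)
    also have "\<dots> = (LINT \<omega>|sphere_measure. poisson_kernel x \<omega> * (g \<omega> - g x))"
      using pk pkg by (simp add: right_diff_distrib)
    finally have "\<bar>poisson_integral g x - g x\<bar> \<le> (LINT \<omega>|sphere_measure. \<bar>poisson_kernel x \<omega> * (g \<omega> - g x)\<bar>)"
      using integral_norm_bound[of sphere_measure "\<lambda>\<omega>. poisson_kernel x \<omega> * (g \<omega> - g x)"] by simp
    also have "\<dots> \<le> (LINT \<omega>|sphere_measure. poisson_kernel x \<omega> * (e / 2) + c)"
    proof (rule integral_mono)
      show "integrable sphere_measure (\<lambda>\<omega>. \<bar>poisson_kernel x \<omega> * (g \<omega> - g x)\<bar>)"
        using diff_int by simp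
      show "integrable sphere_measure (\<lambda>\<omega>. poisson_kernel x \<omega> * (e / 2) + c)"
        using pk by simp
      fix \<omega> :: "real^'n"
      assume "\<omega> \<in> space sphere_measure"
      then have \<omega>: "norm \<omega> = 1"
        by simp
      have pk0: "0 \<le> poisson_kernel x \<omega>"
        using x by (intro poisson_kernel_nonneg) simp
      have c0: "0 \<le> c"
        unfolding c_def using num \<delta>(1) M0 by simp
      show "\<bar>poisson_kernel x \<omega> * (g \<omega> - g x)\<bar> \<le> poisson_kernel x \<omega> * (e / 2) + c"
      proof (cases "dist \<omega> x < \<delta>")
        case True
        then have "\<bar>g \<omega> - g x\<bar> \<le> e / 2"
          using \<delta>(2)[of x \<omega>] x \<omega> by (simp add: dist_real_def)
        then have "poisson_kernel x \<omega> * \<bar>g \<omega> - g x\<bar> \<le> poisson_kernel x \<omega> * (e / 2)"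
          using pk0 by (rule mult_left_mono)
        then show ?thesis
          using c0 pk0 by (simp add: abs_mult)
      next
        case False
        then have "\<delta> ^ CARD('n) \<le> norm (x - \<omega>) ^ CARD('n)"
          using \<delta>(1) by (intro power_mono) (auto simp: dist_norm norm_minus_commute)
        then have "poisson_kernel x \<omega> \<le> (1 - (norm x)\<^sup>2) / \<delta> ^ CARD('n)"
          unfolding poisson_kernel_def using num \<delta>(1) by (intro frac_le) auto
        moreover have "\<bar>g \<omega> - g x\<bar> \<le> 2 * M"
          using M[of \<omega>] M[of x] x \<omega> by linarith
        ultimately have "poisson_kernel x \<omega> * \<bar>g \<omega> - g x\<bar> \<le> c"
          unfolding c_def using pk0 num \<delta>(1) by (intro mult_mono) auto
        then show ?thesis
          using pk0 e by (simp add: abs_mult add_increasing)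
      qed
    qed
    also have "\<dots> = e / 2 + c"
      using pk integral_poisson_kernel[OF x(2)] by (simp add: sphere.prob_space[simplified])
    finally show "\<bar>poisson_integral g x - g x\<bar> \<le> e"
      using c by simp
  qed (use \<eta> in simp)
qed

text \<open>The difference of the two sides is weakly harmonic and at most \<open>e\<close> in
  absolute value near the boundary, so the maximum principle for both signs bounds it inside. On the
  unit sphere itself \<open>poisson_integral\<close> evaluates to 0, hence the comparison on a
  sphere of radius \<open>R < 1\<close>.\<close>

lemma poisson_formula:
  fixes h :: "real^('n::finite) \<Rightarrow> real"
  assumes cont: "continuous_on (cball 0 1) h" and harm: "\<And>x. norm x < 1 \<Longrightarrow> weakly_harmonic_at h x"
    and x: "norm x < 1"
  shows "poisson_integral h x = h x"
proof -
  have "\<bar>poisson_integral h x - h x\<bar> \<le> e" if e: "e > 0" for e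
  proof -
    obtain s where s: "s < 1" "\<And>x. s \<le> norm x \<Longrightarrow> norm x < 1 \<Longrightarrow> \<bar>poisson_integral h x - h x\<bar> \<le> e"
      using poisson_integral_boundary[OF cont e] by blast
    define R where "R = max s (norm x)"
    have R: "R < 1" "s \<le> R" "norm x \<le> R"
      using s(1) x by (auto simp: R_def)
    have hs: "continuous_on (sphere 0 1) h"
      using cont by (rule continuous_on_subset) auto
    have hR: "continuous_on (cball 0 R) h"
      using cont by (rule continuous_on_subset) (use R in auto)
    have "poisson_integral h x - h x \<le> e"
    proof (rule weak_maximum_principle[where R=R])
      show "continuous_on (cball 0 R) (\<lambda>x. poisson_integral h x - h x)"
        by (intro continuous_intros continuous_on_poisson_integral R hs hR)
      show "weakly_harmonic_at (\<lambda>x. poisson_integral h x - h x) y" if "y \<in> ball 0 R" for y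
        using that R by (intro weakly_harmonic_at_diff weakly_harmonic_at_poisson_integral hs harm) auto
      show "poisson_integral h y - h y \<le> e" if "norm y = R" for y
        using s(2)[of y] that R by auto
    qed (rule R)
    moreover have "h x - poisson_integral h x \<le> e"
    proof (rule weak_maximum_principle[where R=R])
      show "continuous_on (cball 0 R) (\<lambda>x. h x - poisson_integral h x)"
        by (intro continuous_intros continuous_on_poisson_integral R hs hR)
      show "weakly_harmonic_at (\<lambda>x. h x - poisson_integral h x) y" if "y \<in> ball 0 R" for y
        using that R by (intro weakly_harmonic_at_diff weakly_harmonic_at_poisson_integral hs harm) auto
      show "h y - poisson_integral h y \<le> e" if "norm y = R" for y
        using s(2)[of y] that R by auto
    qed (rule R)
    ultimately show ?thesis
      by linarith
  qed
  then show ?thesis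
    by (metis abs_le_zero_iff dense_ge eq_iff_diff_eq_0)
qed

section \<open>Harmonic maps and their dilations\<close>

text \<open>Each derivative brings out a factor \<open>\<rho>\<close>, so the quotients tend to
  \<open>\<rho>\<^sup>2\<close> times the Laplacian at \<open>\<rho> *\<^sub>R x\<close>. The value
  \<open>\<rho> = 1\<close> covers \<open>h\<close> itself.\<close>

lemma C2_on_imp_weakly_harmonic_at_dilation:
  fixes h :: "real^('n::finite) \<Rightarrow> real"
  assumes h: "C2_on h S" "\<And>x. x \<in> S \<Longrightarrow> laplacian h x = 0"
    and S: "open S" and x: "\<rho> *\<^sub>R x \<in> S"
  shows "weakly_harmonic_at (\<lambda>x. h (\<rho> *\<^sub>R x)) x"
proof -
  let ?S = "(\<lambda>x. \<rho> *\<^sub>R x) -` S"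
  have line: "((\<lambda>t. f (\<rho> *\<^sub>R (x + t *\<^sub>R axis i 1))) has_real_derivative
      partial_deriv i f (\<rho> *\<^sub>R (x + t *\<^sub>R axis i 1)) * \<rho>) (at t)"
    if "C1_on f S" "x + t *\<^sub>R axis i 1 \<in> ?S" for f and i :: 'n and t
  proof -
    have e: "\<rho> *\<^sub>R (x + t *\<^sub>R axis i 1) = \<rho> *\<^sub>R x + (\<rho> * t) *\<^sub>R axis i 1" for t
      by (simp add: scaleR_add_right)
    have "((\<lambda>t. f (\<rho> *\<^sub>R x + t *\<^sub>R axis i 1)) has_real_derivative
        partial_deriv i f (\<rho> *\<^sub>R x + (\<rho> * t) *\<^sub>R axis i 1)) (at (\<rho> * t))"
      using that by (intro C1_on_has_line_derivative[where S=S]) (auto simp: e)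
    then show ?thesis
      unfolding e by (rule DERIV_chain2) (auto intro!: derivative_eq_intros)
  qed
  have "(\<lambda>k. lap_quotient (\<lambda>x. h (\<rho> *\<^sub>R x)) x (inverse (real (Suc k)))) \<longlonglongrightarrow>
      (\<Sum>i\<in>UNIV. partial_deriv i (partial_deriv i h) (\<rho> *\<^sub>R x) * \<rho> * \<rho>)"
  proof (rule lap_quotient_tendsto_sum[where S="?S" and f'="\<lambda>i x. partial_deriv i h (\<rho> *\<^sub>R x) * \<rho>"
        and f''="\<lambda>i x. partial_deriv i (partial_deriv i h) (\<rho> *\<^sub>R x) * \<rho> * \<rho>"])
    show "open ?S"
      using S by (intro open_vimage continuous_intros) auto
    show "x \<in> ?S"
      using x by simp
    fix i :: 'n
    have "continuous_on S (partial_deriv i (partial_deriv i h))"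
      using h(1) by (simp add: C2_on_def C1_on_def)
    then have "continuous_on ?S (\<lambda>x. partial_deriv i (partial_deriv i h) (\<rho> *\<^sub>R x))"
      by (rule continuous_on_compose2[where f="\<lambda>x. \<rho> *\<^sub>R x"]) (auto intro!: continuous_intros)
    then show "continuous_on ?S (\<lambda>x. partial_deriv i (partial_deriv i h) (\<rho> *\<^sub>R x) * \<rho> * \<rho>)"
      by (intro continuous_on_mult_right)
    fix t
    assume t: "x + t *\<^sub>R axis i 1 \<in> ?S"
    show "((\<lambda>t. h (\<rho> *\<^sub>R (x + t *\<^sub>R axis i 1))) has_real_derivative
        partial_deriv i h (\<rho> *\<^sub>R (x + t *\<^sub>R axis i 1)) * \<rho>) (at t)"
      using h(1) t by (intro line) (simp_all add: C2_on_def)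
    show "((\<lambda>t. partial_deriv i h (\<rho> *\<^sub>R (x + t *\<^sub>R axis i 1)) * \<rho>) has_real_derivative
        partial_deriv i (partial_deriv i h) (\<rho> *\<^sub>R (x + t *\<^sub>R axis i 1)) * \<rho> * \<rho>) (at t)"
      using h(1) t by (intro DERIV_cmult_right line) (simp_all add: C2_on_def)
  qed
  then show ?thesis
    using h(2)[OF x] by (simp add: weakly_harmonic_at_def laplacian_def flip: sum_distrib_right)
qed

lemma harmonic_map_on_continuous_on:
  assumes F: "harmonic_map_on F S" and S: "open S"
  shows "continuous_on S F"
proof -
  have "continuous_on S (\<lambda>x. \<chi> k. F x $ k)"
    using F S by (intro continuous_on_vec_lambda C1_on_imp_continuous_on)
      (auto simp: harmonic_map_on_def C2_on_def)
  then show ?thesis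
    by simp
qed

lemma harmonic_map_on_inner_weakly_harmonic_at:
  assumes F: "harmonic_map_on F S" and S: "open S" and x: "\<rho> *\<^sub>R x \<in> S"
  shows "weakly_harmonic_at (\<lambda>x. F (\<rho> *\<^sub>R x) \<bullet> c) x"
proof -
  have "weakly_harmonic_at (\<lambda>x. \<Sum>k\<in>UNIV. c $ k * F (\<rho> *\<^sub>R x) $ k) x"
    using F by (intro weakly_harmonic_at_sum weakly_harmonic_at_cmult
        C2_on_imp_weakly_harmonic_at_dilation[OF _ _ S x]) (auto simp: harmonic_map_on_def)
  then show ?thesis
    by (simp add: inner_vec_def mult.commute)
qed

text \<open>The dilated map is continuous up to the unit sphere; pairing it with an arbitrary vector
  \<open>c\<close> reduces the claim to the scalar formula.\<close>

lemma harmonic_map_poisson_formula: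
  fixes F :: "real^('n::finite) \<Rightarrow> real^('k::finite)"
  assumes F: "harmonic_map_on F (ball 0 1)" and \<rho>: "0 \<le> \<rho>" "\<rho> < 1" and x: "norm x < 1"
  shows "(LINT \<omega>|sphere_measure. poisson_kernel x \<omega> *\<^sub>R F (\<rho> *\<^sub>R \<omega>)) = F (\<rho> *\<^sub>R x)"
proof -
  have in_ball: "\<rho> *\<^sub>R y \<in> ball 0 1" if "norm y \<le> 1" for y :: "real^'n"
    using mult_left_le[OF that \<rho>(1)] \<rho> by simp
  have cont: "continuous_on (cball 0 1) (\<lambda>y. F (\<rho> *\<^sub>R y))"
    by (rule continuous_on_compose2[OF harmonic_map_on_continuous_on[OF F open_ball]])
      (use in_ball in \<open>auto intro!: continuous_intros\<close>)
  have int: "integrable sphere_measure (\<lambda>\<omega>. poisson_kernel x \<omega> *\<^sub>R F (\<rho> *\<^sub>R \<omega>))"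
    by (rule integrable_poisson_kernel[OF x continuous_on_subset[OF cont]]) auto
  show ?thesis
  proof (rule vector_eq_ldot[THEN iffD1], intro allI)
    fix c
    have "poisson_integral (\<lambda>y. F (\<rho> *\<^sub>R y) \<bullet> c) x = F (\<rho> *\<^sub>R x) \<bullet> c"
      using in_ball
      by (intro poisson_formula x continuous_intros cont harmonic_map_on_inner_weakly_harmonic_at[OF F open_ball]) simp
    moreover have "poisson_integral (\<lambda>y. F (\<rho> *\<^sub>R y) \<bullet> c) x =
        (LINT \<omega>|sphere_measure. (poisson_kernel x \<omega> *\<^sub>R F (\<rho> *\<^sub>R \<omega>)) \<bullet> c)"
      by (simp add: poisson_integral_eq)
    moreover have "\<dots> = (LINT \<omega>|sphere_measure. poisson_kernel x \<omega> *\<^sub>R F (\<rho> *\<^sub>R \<omega>)) \<bullet> c"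
      by (rule integral_inner_left) (rule int)
    ultimately show "c \<bullet> (LINT \<omega>|sphere_measure. poisson_kernel x \<omega> *\<^sub>R F (\<rho> *\<^sub>R \<omega>)) = c \<bullet> F (\<rho> *\<^sub>R x)"
      by (simp add: inner_commute)
  qed
qed

subsection \<open>The extremal mapping\<close>

lemma inner_vec_pair: "vec_pair a b \<bullet> vec_pair a' b' = a \<bullet> a' + b * b'"
proof -
  have "vec_pair a b \<bullet> vec_pair a' b' = (\<Sum>k\<in>UNIV <+> UNIV. vec_pair a b $ k * vec_pair a' b' $ k)"
    by (simp only: inner_vec_def UNIV_Plus_UNIV inner_real_def)
  also have "\<dots> = a \<bullet> a' + b * b'"
    by (simp add: sum.Plus vec_pair_def inner_vec_def)
  finally show ?thesis .
qed

lemma vec_pair_init_last [simp]: "vec_pair (vec_init x) (vec_last x) = x"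
proof -
  have "Inr k = (Inr 1 :: 'a + 1)" for k
    by simp
  then show ?thesis
    by (auto simp: vec_eq_iff vec_pair_def vec_init_def vec_last_def split: sum.split)
qed

lemma norm_vec_pair: "norm (vec_pair a b) = sqrt ((norm a)\<^sup>2 + b\<^sup>2)"
  by (simp add: norm_eq_sqrt_inner inner_vec_pair power2_eq_square[of b])

lemma bounded_linear_vec_init: "bounded_linear vec_init"
  by (intro linear_conv_bounded_linear[THEN iffD1] linearI) (simp_all add: vec_init_def vec_eq_iff)

lemma bounded_linear_vec_last: "bounded_linear vec_last"
  by (intro linear_conv_bounded_linear[THEN iffD1] linearI) (simp_all add: vec_last_def)

lemma norm_north_pole [simp]: "norm north_pole = 1"
  by (simp add: north_pole_def)

lemma norm_first_axis [simp]: "norm first_axis = 1"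
  by (simp add: first_axis_def)

text \<open>For unit vectors \<open>\<omega>\<close> the squared distance to
  \<open>r *\<^sub>R p\<close> is \<open>r\<^sup>2 + 1 - 2 * r * (\<omega> \<bullet> p)\<close>. As
  \<open>r > 0\<close>, a level set of the kernel lies in a slice of constant
  \<open>\<omega> \<bullet> p\<close>, which is null.\<close>

lemma AE_poisson_kernel_neq:
  fixes p :: "real^('n::finite)"
  assumes n: "CARD('n) \<ge> 2" and p: "norm p = 1" and r: "0 < r" "r < 1"
  shows "AE \<omega> in sphere_measure. poisson_kernel (r *\<^sub>R p) \<omega> \<noteq> t"
proof (cases "\<exists>\<omega>. norm \<omega> = 1 \<and> poisson_kernel (r *\<^sub>R p) \<omega> = t")
  case True
  then obtain \<omega>0 where \<omega>0: "norm \<omega>0 = 1" "poisson_kernel (r *\<^sub>R p) \<omega>0 = t"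
    by blast
  have level: "\<omega> \<bullet> p = \<omega>0 \<bullet> p" if \<omega>: "norm \<omega> = 1" "poisson_kernel (r *\<^sub>R p) \<omega> = t" for \<omega>
  proof -
    have num: "1 - (norm (r *\<^sub>R p))\<^sup>2 \<noteq> 0"
      using p r by (simp add: abs_square_eq_1)
    have neq: "norm (r *\<^sub>R p - \<eta>) > 0" if "norm \<eta> = 1" for \<eta>
      using that p r by auto
    have "norm (r *\<^sub>R p - \<omega>) ^ CARD('n) = norm (r *\<^sub>R p - \<omega>0) ^ CARD('n)"
      using \<omega>(2) \<omega>0(2) num neq[OF \<omega>(1)] neq[OF \<omega>0(1)] unfolding poisson_kernel_def
      by (auto simp: divide_eq_eq eq_divide_eq)
    then have "norm (r *\<^sub>R p - \<omega>) = norm (r *\<^sub>R p - \<omega>0)"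
      by (rule power_eq_imp_eq_base) simp_all
    moreover have "(norm (r *\<^sub>R p - \<eta>))\<^sup>2 = r\<^sup>2 + 1 - 2 * r * (\<eta> \<bullet> p)" if "norm \<eta> = 1" for \<eta>
    proof -
      have "(norm (r *\<^sub>R p - \<eta>))\<^sup>2 = r * r * (p \<bullet> p) + \<eta> \<bullet> \<eta> - 2 * r * (\<eta> \<bullet> p)"
        unfolding power2_norm_eq_inner
        by (simp only: inner_diff_left inner_diff_right inner_scaleR_left inner_scaleR_right inner_commute)
      then show ?thesis
        using p that by (simp add: dot_square_norm power2_eq_square)
    qed
    ultimately have "r\<^sup>2 + 1 - 2 * r * (\<omega> \<bullet> p) = r\<^sup>2 + 1 - 2 * r * (\<omega>0 \<bullet> p)"
      using \<omega>(1) \<omega>0(1) by metis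
    then show ?thesis
      using r by simp
  qed
  show ?thesis
    using AE_sphere_inner_neq[OF n p, of "\<omega>0 \<bullet> p"] AE_space by eventually_elim (auto dest: level)
next
  case False
  then show ?thesis
    by (intro AE_I2) auto
qed

lemma extremal_functional_eq:
  assumes "0 < r"
  shows "extremal_functional r (u :: real^('n::{finite,linorder}) \<Rightarrow> _) =
    (LINT \<omega>|sphere_measure. poisson_kernel (r *\<^sub>R north_pole) \<omega> * (u \<omega> \<bullet> first_axis))"
  using assms by (simp add: extremal_functional_def poisson_kernel_def)

text \<open>The right-hand side is the maximum of the functional over the class for
  \<open>\<bar>b\<bar>\<close>: duality exhibits a maximizer, so the chosen
  \<open>extremal_fun\<close> is one too, and the inner product with \<open>first_axis\<close>
  passes through its Poisson integral.\<close>

lemma extremal_map_inner_e\<^sub>0: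
  fixes a :: "real^('m::{finite,linorder})" and N :: "real^('n::{finite,linorder})"
  assumes n: "CARD('n) \<ge> 2" and r: "0 < r" "r < 1" and ab: "norm (vec_pair a b) < 1"
    and N: "N = north_pole" and u: "u \<in> extremal_class a \<bar>b\<bar>"
  shows "extremal_functional r (u :: (real, 'n) vec \<Rightarrow> _) \<le> extremal_map a b r (r *\<^sub>R N) \<bullet> e\<^sub>0"
proof -
  let ?\<kappa> = "poisson_kernel (r *\<^sub>R N)"
  have rN: "norm (r *\<^sub>R N) < 1"
    using r by (simp add: N)
  have \<kappa>: "integrable sphere_measure ?\<kappa>"
    by (intro continuous_on_sphere_integrable continuous_on_poisson_kernel rN)
  have ab': "norm (a, \<bar>b\<bar>) < 1"
    using ab by (simp add: norm_vec_pair norm_prod_def)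
  have l: "(first_axis :: (real, 'm) vec) \<noteq> 0"
    using norm_first_axis by (metis norm_zero zero_neq_one)
  have "\<exists>w. is_arg_max (extremal_functional r) (\<lambda>w. w \<in> (extremal_class a \<bar>b\<bar> :: ((real, 'n) vec \<Rightarrow> _) set)) w"
  proof (rule sphere.exists_extremal_function[where \<kappa>="?\<kappa>" and l="first_axis :: (real, 'm) vec", OF \<kappa> _ l ab'])
    show "AE \<omega> in sphere_measure. ?\<kappa> \<omega> \<noteq> t" for t
      using r by (intro AE_poisson_kernel_neq n) (simp_all add: N)
    fix w :: "(real, 'n) vec \<Rightarrow> (real, 'm) vec"
    assume w: "w \<in> borel_measurable sphere_measure" "AE \<omega> in sphere_measure. norm (w \<omega>) \<le> 1"
      "(LINT \<omega>|sphere_measure. w \<omega>) = a" "(LINT \<omega>|sphere_measure. sqrt (1 - (norm (w \<omega>))\<^sup>2)) = \<bar>b\<bar>"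
      and max: "\<And>u'. u' \<in> borel_measurable sphere_measure \<Longrightarrow> AE \<omega> in sphere_measure. norm (u' \<omega>) \<le> 1 \<Longrightarrow>
        (LINT \<omega>|sphere_measure. u' \<omega>) = a \<Longrightarrow>
        \<bar>b\<bar> \<le> (LINT \<omega>|sphere_measure. sqrt (1 - (norm (u' \<omega>))\<^sup>2)) \<Longrightarrow>
        (LINT \<omega>|sphere_measure. ?\<kappa> \<omega> * (u' \<omega> \<bullet> first_axis)) \<le>
        (LINT \<omega>|sphere_measure. ?\<kappa> \<omega> * (w \<omega> \<bullet> first_axis))"
    show ?thesis
      using w max unfolding is_arg_max_linorder extremal_functional_eq[OF r(1)] N extremal_class_def
      by (intro exI[of _ w]) auto
  qed simp
  then have "is_arg_max (extremal_functional r) (\<lambda>w. w \<in> extremal_class a \<bar>b\<bar>)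
      (extremal_fun a \<bar>b\<bar> r :: (real, 'n) vec \<Rightarrow> _)"
    unfolding extremal_fun_def arg_max_on_def arg_max_def by (rule someI_ex)
  then have mem: "(extremal_fun a \<bar>b\<bar> r :: (real, 'n) vec \<Rightarrow> _) \<in> extremal_class a \<bar>b\<bar>"
    and max: "extremal_functional r u \<le> extremal_functional r (extremal_fun a \<bar>b\<bar> r :: (real, 'n) vec \<Rightarrow> _)"
    using u by (auto simp: is_arg_max_linorder)
  let ?u = "extremal_fun a \<bar>b\<bar> r :: (real, 'n) vec \<Rightarrow> _"
  have u_m [measurable]: "?u \<in> borel_measurable sphere_measure" and u1: "AE \<omega> in sphere_measure. norm (?u \<omega>) \<le> 1"
    using mem by (auto simp: extremal_class_def)
  have int: "integrable sphere_measure (\<lambda>\<omega>. ?\<kappa> \<omega> *\<^sub>R ?u \<omega>)"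
  proof (rule Bochner_Integration.integrable_bound[OF \<kappa>])
    show "(\<lambda>\<omega>. ?\<kappa> \<omega> *\<^sub>R ?u \<omega>) \<in> borel_measurable sphere_measure"
      using \<kappa> by measurable
    show "AE \<omega> in sphere_measure. norm (?\<kappa> \<omega> *\<^sub>R ?u \<omega>) \<le> norm (?\<kappa> \<omega>)"
      using u1 by eventually_elim (simp add: mult_left_le)
  qed
  have "extremal_map a b r (r *\<^sub>R N) \<bullet> e\<^sub>0 = poisson_integral ?u (r *\<^sub>R N) \<bullet> first_axis"
    by (simp add: extremal_map_def e\<^sub>0_def inner_vec_pair extremal_U_def)
  also have "\<dots> = extremal_functional r ?u"
    unfolding poisson_integral_eq extremal_functional_eq[OF r(1)]
    using integral_inner_left[OF int, of first_axis] by (simp add: N)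
  finally show ?thesis
    using max by simp
qed

text \<open>
  Instead of the radial boundary values of \<open>F\<close> the proof uses \<open>\<omega> \<mapsto> F (\<rho> T \<omega>)\<close> for \<open>\<rho> < 1\<close>, rotated by \<open>L\<close>:
  its first \<open>m\<close> components lie in the extremal class, and the Poisson formula evaluates their functional.
\<close>

lemma harmonic_map_inner_le_extremal:
  fixes F :: "real^('n::{finite,linorder}) \<Rightarrow> real^('m::{finite,linorder} + 1)"
    and L :: "(real, 'm + 1) vec \<Rightarrow> (real, 'm + 1) vec" and N :: "(real, 'n) vec"
  assumes n: "CARD('n) \<ge> 2" and F: "harmonic_map_on F (ball 0 1)" and ball: "F ` ball 0 1 \<subseteq> ball 0 1"
    and r: "0 < r" "r < 1" and L: "orthogonal_transformation L" and \<rho>: "0 < \<rho>" "\<rho> < 1"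
    and N: "N = north_pole" and x: "norm x = r"
  shows "L (F (\<rho> *\<^sub>R x)) \<bullet> e\<^sub>0 \<le> extremal_map (vec_init (L (F 0))) (vec_last (L (F 0))) r (r *\<^sub>R N) \<bullet> e\<^sub>0"
proof -
  obtain T :: "(real, 'n) vec \<Rightarrow> (real, 'n) vec" where T: "orthogonal_transformation T" "T (r *\<^sub>R N) = x"
    using orthogonal_transformation_exists[of "r *\<^sub>R N" x] x r by (auto simp: N)
  have nT: "norm (T \<omega>) = norm \<omega>" for \<omega>
    using T(1) by (rule orthogonal_transformation_norm)
  have nL: "norm (L y) = norm y" for y
    using L by (rule orthogonal_transformation_norm)
  have L_bl: "bounded_linear L"
    using L by (simp add: orthogonal_transformation_linear linear_conv_bounded_linear[symmetric])
  define f where "f \<omega> = F (\<rho> *\<^sub>R T \<omega>)" for \<omega>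
  have in_ball: "\<rho> *\<^sub>R T \<omega> \<in> ball 0 1" if "norm \<omega> = 1" for \<omega>
    using that \<rho> by (simp add: nT)
  have f_cont: "continuous_on (sphere 0 1) f"
    unfolding f_def
  proof (rule continuous_on_compose2[OF harmonic_map_on_continuous_on[OF F open_ball]])
    show "continuous_on (sphere 0 1) (\<lambda>\<omega>. \<rho> *\<^sub>R T \<omega>)"
      using T(1) by (intro continuous_on_scaleR continuous_on_const linear_continuous_on)
        (simp add: orthogonal_transformation_linear linear_conv_bounded_linear[symmetric])
    show "(\<lambda>\<omega>. \<rho> *\<^sub>R T \<omega>) ` sphere 0 1 \<subseteq> ball 0 1"
      using in_ball by auto
  qed
  have f_formula: "(LINT \<omega>|sphere_measure. poisson_kernel y \<omega> *\<^sub>R f \<omega>) = F (\<rho> *\<^sub>R T y)" if y: "norm y < 1" for y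
  proof -
    have F_cont: "continuous_on (sphere 0 1) (\<lambda>\<omega>. F (\<rho> *\<^sub>R \<omega>))"
      by (rule continuous_on_compose2[OF harmonic_map_on_continuous_on[OF F open_ball]])
        (use \<rho> in \<open>auto intro!: continuous_intros\<close>)
    have "(LINT \<omega>|sphere_measure. poisson_kernel y \<omega> *\<^sub>R f \<omega>) =
        (LINT \<omega>|sphere_measure. poisson_kernel (T y) (T \<omega>) *\<^sub>R F (\<rho> *\<^sub>R T \<omega>))"
      by (simp add: poisson_kernel_orthogonal[OF T(1)] f_def)
    also have "\<dots> = (LINT \<omega>|sphere_measure. poisson_kernel (T y) \<omega> *\<^sub>R F (\<rho> *\<^sub>R \<omega>))"
      using y F_cont
      by (intro integral_sphere_measure_orthogonal[OF T(1)] borel_measurable_integrable integrable_poisson_kernel)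
        (simp_all add: nT)
    also have "\<dots> = F (\<rho> *\<^sub>R T y)"
      using y \<rho> by (intro harmonic_map_poisson_formula[OF F]) (simp_all add: nT)
    finally show ?thesis .
  qed
  \<comment> \<open>The kernel at the origin is constantly 1 on the sphere, and \<open>T\<close>
    fixes the origin.\<close>
  have f_mean: "(LINT \<omega>|sphere_measure. f \<omega>) = F 0"
  proof -
    have "(LINT \<omega>|sphere_measure. f \<omega>) = (LINT \<omega>|sphere_measure. poisson_kernel 0 \<omega> *\<^sub>R f \<omega>)"
      by (intro Bochner_Integration.integral_cong) (simp_all add: poisson_kernel_0)
    then show ?thesis
      using f_formula[of 0] T(1) by (simp add: orthogonal_transformation_linear linear_0)
  qed
  have init_bl: "bounded_linear (\<lambda>y. vec_init (L y))" and last_bl: "bounded_linear (\<lambda>y. vec_last (L y))"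
    by (intro bounded_linear_compose[OF bounded_linear_vec_init L_bl]
        bounded_linear_compose[OF bounded_linear_vec_last L_bl])+
  define u where "u \<omega> = vec_init (L (f \<omega>))" for \<omega>
  define v where "v \<omega> = vec_last (L (f \<omega>))" for \<omega>
  have u_cont: "continuous_on (sphere 0 1) u" and v_cont: "continuous_on (sphere 0 1) v"
    unfolding u_def v_def using f_cont
    by (rule bounded_linear.continuous_on[OF init_bl] bounded_linear.continuous_on[OF last_bl])+
  have f_int: "integrable sphere_measure f"
    using f_cont by (rule continuous_on_sphere_integrable)
  have uv: "(norm (u \<omega>))\<^sup>2 + (v \<omega>)\<^sup>2 \<le> 1" if "norm \<omega> = 1" for \<omega>
  proof -
    have "F (\<rho> *\<^sub>R T \<omega>) \<in> ball 0 1"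
      using in_ball[OF that] ball by blast
    then have "norm (vec_pair (u \<omega>) (v \<omega>)) < 1"
      by (simp add: u_def v_def f_def nL)
    then show ?thesis
      by (simp add: norm_vec_pair)
  qed
  have "u \<in> extremal_class (vec_init (L (F 0))) \<bar>vec_last (L (F 0))\<bar>"
    unfolding extremal_class_def
  proof (intro CollectI conjI)
    show "u \<in> borel_measurable sphere_measure"
      using u_cont by (rule continuous_on_sphere_measurable)
    show "AE \<omega> in sphere_measure. norm (u \<omega>) \<le> 1"
    proof (rule AE_I2)
      fix \<omega> :: "(real, 'n) vec"
      assume "\<omega> \<in> space sphere_measure"
      then have "(norm (u \<omega>))\<^sup>2 \<le> 1\<^sup>2"
        using uv[of \<omega>] zero_le_power2[of "v \<omega>"] unfolding space_sphere_measure mem_sphere_0 one_power2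
        by linarith
      then show "norm (u \<omega>) \<le> 1"
        by (rule power2_le_imp_le) simp
    qed
    show "(LINT \<omega>|sphere_measure. u \<omega>) = vec_init (L (F 0))"
      unfolding u_def using integral_bounded_linear[OF init_bl f_int] by (simp add: f_mean)
    have "\<bar>vec_last (L (F 0))\<bar> = norm (LINT \<omega>|sphere_measure. v \<omega>)"
      unfolding v_def using integral_bounded_linear[OF last_bl f_int] by (simp add: f_mean)
    also have "\<dots> \<le> (LINT \<omega>|sphere_measure. norm (v \<omega>))"
      by (rule integral_norm_bound)
    also have "\<dots> \<le> (LINT \<omega>|sphere_measure. sqrt (1 - (norm (u \<omega>))\<^sup>2))"
    proof (rule integral_mono)
      show "integrable sphere_measure (\<lambda>\<omega>. norm (v \<omega>))"
        by (intro continuous_on_sphere_integrable continuous_on_norm v_cont)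
      show "integrable sphere_measure (\<lambda>\<omega>. sqrt (1 - (norm (u \<omega>))\<^sup>2))"
        by (intro continuous_on_sphere_integrable continuous_intros u_cont)
      show "norm (v \<omega>) \<le> sqrt (1 - (norm (u \<omega>))\<^sup>2)" if "\<omega> \<in> space sphere_measure" for \<omega>
        using uv[of \<omega>] that by (intro real_le_rsqrt) simp
    qed
    finally show "\<bar>vec_last (L (F 0))\<bar> \<le> (LINT \<omega>|sphere_measure. sqrt (1 - (norm (u \<omega>))\<^sup>2))" .
  qed
  \<comment> \<open>The strict inequality comes from the open target ball and is what coercivity of
    the dual objective rests on.\<close>
  moreover have "norm (vec_pair (vec_init (L (F 0))) (vec_last (L (F 0)))) < 1"
    using ball by (auto simp: nL image_subset_iff)
  ultimately have "extremal_functional r u \<le>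
      extremal_map (vec_init (L (F 0))) (vec_last (L (F 0))) r (r *\<^sub>R N) \<bullet> e\<^sub>0"
    by (intro extremal_map_inner_e\<^sub>0 n r N)
  moreover have "extremal_functional r u = L (F (\<rho> *\<^sub>R x)) \<bullet> e\<^sub>0"
  proof -
    let ?\<kappa> = "poisson_kernel (r *\<^sub>R N)"
    have rN: "norm (r *\<^sub>R N) < 1"
      using r by (simp add: N)
    have "extremal_functional r u = (LINT \<omega>|sphere_measure. (?\<kappa> \<omega> *\<^sub>R u \<omega>) \<bullet> first_axis)"
      by (simp add: extremal_functional_eq[OF r(1)] N)
    also have "\<dots> = (LINT \<omega>|sphere_measure. ?\<kappa> \<omega> *\<^sub>R u \<omega>) \<bullet> first_axis"
      by (rule integral_inner_left) (rule integrable_poisson_kernel[OF rN u_cont])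
    also have "(LINT \<omega>|sphere_measure. ?\<kappa> \<omega> *\<^sub>R u \<omega>) = vec_init (L (F (\<rho> *\<^sub>R x)))"
    proof -
      have "(LINT \<omega>|sphere_measure. ?\<kappa> \<omega> *\<^sub>R u \<omega>) =
          (LINT \<omega>|sphere_measure. vec_init (L (?\<kappa> \<omega> *\<^sub>R f \<omega>)))"
        unfolding u_def by (simp only: linear_scale[OF bounded_linear.linear[OF init_bl]])
      also have "\<dots> = vec_init (L (LINT \<omega>|sphere_measure. ?\<kappa> \<omega> *\<^sub>R f \<omega>))"
        by (rule integral_bounded_linear[OF init_bl integrable_poisson_kernel[OF rN f_cont]])
      finally show ?thesis
        by (simp add: f_formula[OF rN] T(2))
    qed
    also have "vec_init (L (F (\<rho> *\<^sub>R x))) \<bullet> first_axis = L (F (\<rho> *\<^sub>R x)) \<bullet> e\<^sub>0"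
      unfolding e\<^sub>0_def using inner_vec_pair[of "vec_init (L (F (\<rho> *\<^sub>R x)))" "vec_last (L (F (\<rho> *\<^sub>R x)))" first_axis 0]
      by simp
    finally show ?thesis .
  qed
  ultimately show ?thesis
    by simp
qed

theorem theorem2:
  fixes F :: "real^('n::{finite,linorder}) \<Rightarrow> real^('m::{finite,linorder} + 1)"
    and a :: "real^('m::{finite,linorder})" and b r :: real
    and Q :: "real^('m::{finite,linorder} + 1) \<Rightarrow> real^('m::{finite,linorder} + 1)^('m::{finite,linorder} + 1)"
  assumes "CARD('n) \<ge> 2"
    and "harmonic_map_on F (ball 0 1)"
    and "F ` ball 0 1 \<subseteq> ball 0 1"
    and "F 0 = vec_pair a b"
    and "0 < r" and "r < 1"
    and "\<And>e. norm e = 1 \<Longrightarrow> orthogonal_matrix (Q e) \<and> e v* Q e = e\<^sub>0"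
  shows "F ` cball 0 r \<subseteq> extremal_region TYPE('n) Q r (vec_pair a b)"
proof -
  note F = assms(2) and r = assms(5,6)
  define N :: "(real, 'n) vec" where "N = north_pole"
  have "F x \<bullet> e \<le> extremal_map (vec_init (vec_pair a b v* Q e)) (vec_last (vec_pair a b v* Q e)) r
      (r *\<^sub>R N) \<bullet> e\<^sub>0" (is "_ \<le> ?M") if e: "norm e = 1" and x: "norm x \<le> r" for e x
  proof -
    define L where "L y = y v* Q e" for y
    have Q: "orthogonal_matrix (transpose (Q e))" and Le: "L e = e\<^sub>0"
      using assms(7)[OF e] by (simp_all add: L_def)
    have "L = (*v) (transpose (Q e))"
      by (simp add: fun_eq_iff L_def)
    then have L: "orthogonal_transformation L"
      using Q by (simp add: orthogonal_transformation_matrix)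
    \<comment> \<open>\<open>L\<close> preserves inner products and sends \<open>e\<close> to
      \<open>e\<^sub>0\<close>, which turns the half-space for \<open>e\<close> into the extremal
      estimate for the rotated map.\<close>
    have L_inner: "F y \<bullet> e = L (F y) \<bullet> e\<^sub>0" for y
      using L by (simp add: orthogonal_transformation_def flip: Le)
    have cont: "continuous_on (ball 0 1) (\<lambda>y. F y \<bullet> e)"
      by (intro continuous_intros harmonic_map_on_continuous_on[OF F open_ball])
    have on_sphere: "F y \<bullet> e \<le> ?M" if y: "norm y = r" for y
    proof (rule LIMSEQ_le_const2)
      \<comment> \<open>The double successor makes the first dilation factor 1/2; with a single one
        it would be 0.\<close>
      let ?\<rho> = "\<lambda>k. 1 - inverse (real (Suc (Suc k)))"
      have "(\<lambda>k. inverse (real (Suc (Suc k)))) \<longlonglongrightarrow> 0"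
        using LIMSEQ_inverse_real_of_nat by (rule LIMSEQ_Suc)
      then have "(\<lambda>k. ?\<rho> k *\<^sub>R y) \<longlonglongrightarrow> (1 - 0) *\<^sub>R y"
        by (intro tendsto_intros)
      moreover have "isCont (\<lambda>y. F y \<bullet> e) y"
        using cont y r by (simp add: continuous_on_eq_continuous_at)
      ultimately show "(\<lambda>k. F (?\<rho> k *\<^sub>R y) \<bullet> e) \<longlonglongrightarrow> F y \<bullet> e"
        using isCont_tendsto_compose[of y "\<lambda>y. F y \<bullet> e" "\<lambda>k. ?\<rho> k *\<^sub>R y" sequentially] by simp
      have "F (?\<rho> k *\<^sub>R y) \<bullet> e \<le> ?M" for k
      proof -
        have "0 < ?\<rho> k" "?\<rho> k < 1"
          by (simp_all add: field_simps)
        from harmonic_map_inner_le_extremal[OF assms(1-3) r L this N_def y] show ?thesis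
          unfolding L_inner assms(4) by (simp only: L_def)
      qed
      then show "\<exists>K. \<forall>k\<ge>K. F (?\<rho> k *\<^sub>R y) \<bullet> e \<le> ?M"
        by blast
    qed
    show ?thesis
    \<comment> \<open>The bound \<open>?M\<close> is the same for every point of the sphere of
      radius \<open>r\<close>, so it extends to the ball.\<close>
    proof (rule weak_maximum_principle[OF _ _ on_sphere x])
      show "continuous_on (cball 0 r) (\<lambda>y. F y \<bullet> e)"
        using cont by (rule continuous_on_subset) (use r in auto)
      show "weakly_harmonic_at (\<lambda>y. F y \<bullet> e) y" if "y \<in> ball 0 r" for y
        using harmonic_map_on_inner_weakly_harmonic_at[OF F open_ball, of 1 y e] that r by simp
    qed
  qed
  then show ?thesis
    by (auto simp: extremal_region_def extremal_halfspace_def N_def)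
qed

end
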